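(* Let $K\ge 1$ and consider the binary-symmetric parallel-relay (BSPR) network with $K$ relays and cross-over probabilities $p_{s,i},p_{i,d}\in[0,\tfrac12]$, $i=1,\dots,K$. Put $p_i=p_{s,i}(1-p_{i,d})+(1-p_{s,i})p_{i,d}$. For any $\mathcal D\subseteq\{1,2,\dots,K\}$ and $\mathcal F=\{1,2,\dots,K\}\setminus\mathcal D$, put $$R_{\mathrm H}=\min\Big\{1-H\big(\max_{i\in\mathcal D}p_{s,i}\big),\ I(U;Y_{\mathcal F})+\sum_{i\in\mathcal D}\big(1-H(p_{i,d})\big)\Big\},$$ where $H\big(\max_{i\in\mathcal D}p_{s,i}\big)$ is taken to be $0$ if $|\mathcal D|=0$, and where $I(U;Y_{\mathcal F})$ is computed for $U$ uniform on $\{0,1\}$ and $Y_{\mathcal F}=(Y_i)_{i\in\mathcal F}$ with $Y_i=U\oplus N_i$, the $N_i$ being binary, independent of each other and of $U$, with $\Pr\{N_i=1\}=p_i$. Then rates up to $R_{\mathrm H}$ are achievable in the network, i.e. every rate $R$ with $0\le R<R_{\mathrm H}$ is achievable.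
   Context: **The BSPR network.** There is one source, $K$ relays $1,\dots,K$, and one destination. All channel inputs, outputs and noises are binary, and $\oplus$ is addition modulo 2. At each time $t=1,2,\dots$ the source transmits $U[t]\in\{0,1\}$ and relay $i$ receives $V_i[t]=U[t]\oplus Z_i[t]$ with $\Pr\{Z_i[t]=1\}=p_{s,i}$; relay $i$ transmits $X_i[t]\in\{0,1\}$ and the destination receives, on a separate link for each $i$, $Y_i[t]=X_i[t]\oplus E_i[t]$ with $\Pr\{E_i[t]=1\}=p_{i,d}$. Here $0\le p_{s,i},p_{i,d}\le \tfrac12$. All the noises $Z_i[t],E_i[t]$ (over all $i,t$) are independent of each other and of the message. **Codes and achievable rates.** A code of rate $R\ge 0$ and length $n$ has a message $W$ uniform on $\{0,1,\dots,\lceil 2^{nR}\rceil-1\}$, a source encoder giving $(U[1],\dots,U[n])$ as a function of $W$, for each relay $i$ and time $t\le n$ a function giving $X_i[t]$ from $(V_i[1],\dots,V_i[t-1])$, and a decoder giving $\hat W$ from $(Y_i[t])_{1\le i\le K,\,1\le t\le n}$. Its error probability is $P_e=\Pr\{\hat W\ne W\}$. A rate $R$ is achievable if for every $\epsilon>0$ and all sufficiently large $n$ there is a code of rate $R$ and length $n$ with $P_e<\epsilon$. $H(q)=-q\log_2 q-(1-q)\log_2(1-q)$ is the binary entropy function (with $0\log_2 0=0$); $I(\cdot\,;\cdot)$ is mutual information with logarithms to base 2 (and is $0$ when $\mathcal F=\emptyset$). Rates are in bits per channel use. *)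

theory Defs
  imports "HOL-Probability.Probability"
begin

text \<open>Bits are booleans, with \<open>True\<close> for 1 and \<open>False\<close> for 0.\<close>

abbreviation (input) xor_bit :: "bool \<Rightarrow> bool \<Rightarrow> bool"  (infixl "\<oplus>" 65)
  where "a \<oplus> b \<equiv> (a \<noteq> b)"

text \<open>The usual convention \<open>0 \<cdot> log 0 = 0\<close> holds automatically.\<close>

definition bin_entropy :: "real \<Rightarrow> real"
  where "bin_entropy q = - q * log 2 q - (1 - q) * log 2 (1 - q)"

text \<open>
  In the network, \<open>ps i\<close> and \<open>pd i\<close> are the cross-over probabilities of the links from the source
  to relay \<open>i\<close> and from relay \<open>i\<close> to the destination. A noise pattern is indexed by pairs
  \<open>(i, t)\<close> of a relay and a time; outside \<open>{1..K} \<times> {1..n}\<close> it is constantly \<open>False\<close>.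
\<close>

definition noise_pmf :: "nat \<Rightarrow> nat \<Rightarrow> (nat \<Rightarrow> real) \<Rightarrow> (nat \<times> nat \<Rightarrow> bool) pmf"
  where "noise_pmf K n q = Pi_pmf ({1..K} \<times> {1..n}) False (\<lambda>(i, t). bernoulli_pmf (q i))"

definition num_messages :: "real \<Rightarrow> nat \<Rightarrow> nat"
  where "num_messages R n = nat \<lceil>2 powr (real n * R)\<rceil>"

text \<open>The joint law of the message, the noises \<open>Z\<close> at the relays and the noises \<open>E\<close> at the destination.\<close>

definition network_pmf ::
    "nat \<Rightarrow> (nat \<Rightarrow> real) \<Rightarrow> (nat \<Rightarrow> real) \<Rightarrow> real \<Rightarrow> nat
      \<Rightarrow> (nat \<times> (nat \<times> nat \<Rightarrow> bool) \<times> (nat \<times> nat \<Rightarrow> bool)) pmf"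
  where "network_pmf K ps pd R n =
    pair_pmf (pmf_of_set {..<num_messages R n})
      (pair_pmf (noise_pmf K n ps) (noise_pmf K n pd))"

text \<open>
  \<open>encode w t\<close> is \<open>U[t]\<close> for message \<open>w\<close>. Relay \<open>i\<close> at time \<open>t\<close> applies \<open>relay i t\<close> to the list
  \<open>[V\<^sub>i[1], \<dots>, V\<^sub>i[t-1]]\<close>. The decoder is applied to the array of the \<open>Y\<^sub>i[t]\<close>, restricted to
  \<open>{1..K} \<times> {1..n}\<close>.
\<close>

record code =
  encode :: "nat \<Rightarrow> nat \<Rightarrow> bool"
  relay  :: "nat \<Rightarrow> nat \<Rightarrow> bool list \<Rightarrow> bool"
  decode :: "(nat \<times> nat \<Rightarrow> bool) \<Rightarrow> nat"

definition relay_received :: "code \<Rightarrow> nat \<Rightarrow> (nat \<times> nat \<Rightarrow> bool) \<Rightarrow> nat \<Rightarrow> nat \<Rightarrow> bool"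
  where "relay_received c w Z i t = encode c w t \<oplus> Z (i, t)"

definition relay_sent :: "code \<Rightarrow> nat \<Rightarrow> (nat \<times> nat \<Rightarrow> bool) \<Rightarrow> nat \<Rightarrow> nat \<Rightarrow> bool"
  where "relay_sent c w Z i t = relay c i t (map (relay_received c w Z i) [1..<t])"

definition dest_received ::
    "code \<Rightarrow> nat \<Rightarrow> (nat \<times> nat \<Rightarrow> bool) \<Rightarrow> (nat \<times> nat \<Rightarrow> bool) \<Rightarrow> nat \<times> nat \<Rightarrow> bool"
  where "dest_received c w Z E = (\<lambda>(i, t). relay_sent c w Z i t \<oplus> E (i, t))"

definition error_prob ::
    "nat \<Rightarrow> (nat \<Rightarrow> real) \<Rightarrow> (nat \<Rightarrow> real) \<Rightarrow> real \<Rightarrow> nat \<Rightarrow> code \<Rightarrow> real"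
  where "error_prob K ps pd R n c =
    measure_pmf.prob (network_pmf K ps pd R n)
      {(w, Z, E). decode c (restrict (dest_received c w Z E) ({1..K} \<times> {1..n})) \<noteq> w}"

definition achievable :: "nat \<Rightarrow> (nat \<Rightarrow> real) \<Rightarrow> (nat \<Rightarrow> real) \<Rightarrow> real \<Rightarrow> bool"
  where "achievable K ps pd R \<longleftrightarrow>
    0 \<le> R \<and> (\<forall>\<epsilon>>0. \<forall>\<^sub>F n in sequentially. \<exists>c. error_prob K ps pd R n c < \<epsilon>)"

definition crossover :: "(nat \<Rightarrow> real) \<Rightarrow> (nat \<Rightarrow> real) \<Rightarrow> nat \<Rightarrow> real"
  where "crossover ps pd i = ps i * (1 - pd i) + (1 - ps i) * pd i"

text \<open>The joint law of \<open>U\<close> and the noises \<open>N\<^sub>i\<close>, \<open>i \<in> F\<close>, and the output tuple \<open>Y\<^sub>F\<close>.\<close>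

definition fwd_pmf :: "(nat \<Rightarrow> real) \<Rightarrow> nat set \<Rightarrow> (bool \<times> (nat \<Rightarrow> bool)) pmf"
  where "fwd_pmf p F = pair_pmf (pmf_of_set UNIV) (Pi_pmf F False (\<lambda>i. bernoulli_pmf (p i)))"

definition fwd_output :: "nat set \<Rightarrow> bool \<times> (nat \<Rightarrow> bool) \<Rightarrow> nat \<Rightarrow> bool"
  where "fwd_output F = (\<lambda>(u, N). \<lambda>i\<in>F. u \<oplus> N i)"

text \<open>
  The mutual information \<open>I(U; Y\<^sub>F)\<close> in bits. The output tuples are the finitely many extensional
  functions on \<open>F\<close>.
\<close>

definition fwd_information :: "(nat \<Rightarrow> real) \<Rightarrow> nat set \<Rightarrow> real"
  where "fwd_information p F =
    prob_space.mutual_information (measure_pmf (fwd_pmf p F)) 2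
      (count_space UNIV) (count_space (F \<rightarrow>\<^sub>E UNIV)) fst (fwd_output F)"

definition hybrid_rate :: "nat \<Rightarrow> (nat \<Rightarrow> real) \<Rightarrow> (nat \<Rightarrow> real) \<Rightarrow> nat set \<Rightarrow> real"
  where "hybrid_rate K ps pd D =
    min (1 - (if D = {} then 0 else bin_entropy (Max (ps ` D))))
        (fwd_information (crossover ps pd) ({1..K} - D) + (\<Sum>i\<in>D. 1 - bin_entropy (pd i)))"

end

theory Submission
  imports Defs
begin

text \<open>
  Block Markov coding with random codebooks. The message is split into digits, one for each of \<open>B\<close>
  blocks of length \<open>m\<close>. Relays in \<open>D\<close> decode each block and send an independent random codeword for
  it during the next block; the other relays repeat what they hear. The destination decodes a digit
  jointly from the repeated symbols of its own block and from the codewords of the next block, which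
  form one memoryless channel with information \<open>I(U; Y\<^sub>F) + (\<Sum>i\<in>D. 1 - H(p\<^sub>i\<^sub>,\<^sub>d))\<close> per letter. All
  decoders look for the codeword whose likelihood ratio exceeds \<open>2 powr (m * \<theta>)\<close> with \<open>\<theta>\<close> strictly
  between the rate and the information. By Markov's inequality a wrong codeword passes with
  probability at most \<open>2 powr (- m * \<theta>)\<close>, and by a Chernoff bound the right one fails with
  probability exponentially small in \<open>m\<close>. Letting \<open>B\<close> be large makes up for the block that is lost.
\<close>

subsection \<open>Products of probability mass functions\<close>

text \<open>Zipping two functions is injective, so each zipped function has one preimage and both
  sides are the same product of point masses. This turns an i.i.d. codeword and an i.i.d. noise word
  into one i.i.d. word of pairs.\<close>

lemma map_pmf_pair_Pi_pmf:
  assumes "finite A"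
  shows "map_pmf (\<lambda>(f, g) x. (f x, g x)) (pair_pmf (Pi_pmf A d p) (Pi_pmf A e q)) =
         Pi_pmf A (d, e) (\<lambda>x. pair_pmf (p x) (q x))"
proof (rule pmf_eqI)
  fix h :: "'a \<Rightarrow> 'b \<times> 'c"
  let ?c = "\<lambda>(f :: 'a \<Rightarrow> 'b, g :: 'a \<Rightarrow> 'c) x. (f x, g x)"
  have inj: "inj ?c"
    by (auto simp: inj_def fun_eq_iff)
  have h: "h = ?c (fst \<circ> h, snd \<circ> h)"
    by auto
  have "pmf (map_pmf ?c (pair_pmf (Pi_pmf A d p) (Pi_pmf A e q))) h =
        pmf (pair_pmf (Pi_pmf A d p) (Pi_pmf A e q)) (fst \<circ> h, snd \<circ> h)"
    using pmf_map_inj'[OF inj, of _ "(fst \<circ> h, snd \<circ> h)"] h by metis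
  also have "\<dots> = pmf (Pi_pmf A (d, e) (\<lambda>x. pair_pmf (p x) (q x))) h"
  proof -
    have "pmf (pair_pmf (p x) (q x)) (h x) = pmf (p x) (fst (h x)) * pmf (q x) (snd (h x))" for x
      using pmf_pair[of "p x" "q x" "fst (h x)" "snd (h x)"] by simp
    then show ?thesis
      using assms by (auto simp: pmf_pair pmf_Pi prod.distrib prod_eq_iff)
  qed
  finally show "pmf (map_pmf ?c (pair_pmf (Pi_pmf A d p) (Pi_pmf A e q))) h =
                pmf (Pi_pmf A (d, e) (\<lambda>x. pair_pmf (p x) (q x))) h" .
qed

text \<open>Lets a noise array indexed by (time, relay) be read as an i.i.d. sequence of noise
  letters. Currying is injective, so point masses are compared; off the support both sides
  vanish.\<close>

lemma map_pmf_curry_Pi_pmf: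
  assumes "finite S" "finite A"
  shows "map_pmf curry (Pi_pmf (S \<times> A) d (\<lambda>(s, i). p s i)) =
         Pi_pmf S (\<lambda>_. d) (\<lambda>s. Pi_pmf A d (p s))"
proof (rule pmf_eqI)
  fix h :: "'a \<Rightarrow> 'b \<Rightarrow> 'c"
  have inj: "inj (curry :: ('a \<times> 'b \<Rightarrow> 'c) \<Rightarrow> _)"
    by (metis case_prod_curry injI)
  have "pmf (map_pmf curry (Pi_pmf (S \<times> A) d (\<lambda>(s, i). p s i))) h =
        pmf (Pi_pmf (S \<times> A) d (\<lambda>(s, i). p s i)) (case_prod h)"
    using pmf_map_inj'[OF inj, of _ "case_prod h"] by simp
  also have "\<dots> = pmf (Pi_pmf S (\<lambda>_. d) (\<lambda>s. Pi_pmf A d (p s))) h"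
  proof (cases "\<forall>s i. (s, i) \<notin> S \<times> A \<longrightarrow> h s i = d")
    case True
    then have "pmf (Pi_pmf (S \<times> A) d (\<lambda>(s, i). p s i)) (case_prod h) =
               (\<Prod>s\<in>S. \<Prod>i\<in>A. pmf (p s i) (h s i))"
      using assms
      by (subst pmf_Pi', simp, force) (auto simp: prod.cartesian_product case_prod_beta)
    also have "\<dots> = (\<Prod>s\<in>S. pmf (Pi_pmf A d (p s)) (h s))"
      using assms True by (intro prod.cong refl) (simp add: pmf_Pi')
    also have "\<dots> = pmf (Pi_pmf S (\<lambda>_. d) (\<lambda>s. Pi_pmf A d (p s))) h"
      using assms True by (subst pmf_Pi') (auto simp: fun_eq_iff)
    finally show ?thesis .
  next
    case False
    then obtain s i where si: "(s, i) \<notin> S \<times> A" "h s i \<noteq> d"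
      by blast
    have "pmf (Pi_pmf S (\<lambda>_. d) (\<lambda>s. Pi_pmf A d (p s))) h = 0"
    \<comment> \<open>The entry with a non-default value lies either in a row of \<open>S\<close>,
      whose factor is then 0, or in a row outside \<open>S\<close>, which would have to be
      constantly \<open>d\<close>.\<close>
    proof (cases "s \<in> S")
      case True
      with si have "pmf (Pi_pmf A d (p s)) (h s) = 0"
        using assms by (intro pmf_Pi_outside) auto
      then have "(\<Prod>s\<in>S. pmf (Pi_pmf A d (p s)) (h s)) = 0"
        using True assms(1) by auto
      with assms(1) show ?thesis
        by (simp add: pmf_Pi)
    next
      case False
      with si assms show ?thesis
        by (intro pmf_Pi_outside) (auto simp: fun_eq_iff)
    qed
    moreover have "pmf (Pi_pmf (S \<times> A) d (\<lambda>(s, i). p s i)) (case_prod h) = 0"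
      using assms si by (intro pmf_Pi_outside) auto
    ultimately show ?thesis by simp
  qed
  finally show "pmf (map_pmf curry (Pi_pmf (S \<times> A) d (\<lambda>(s, i). p s i))) h =
      pmf (Pi_pmf S (\<lambda>_. d) (\<lambda>s. Pi_pmf A d (p s))) h" .
qed

text \<open>Selecting distinct coordinates of a product law gives a product law again. This cuts the
  noise of one block, with its time shift, out of the noise of the whole transmission.\<close>

lemma map_pmf_reindex_Pi_pmf:
  assumes "finite B" "inj_on h A" "h ` A \<subseteq> B"
  shows "map_pmf (\<lambda>f x. if x \<in> A then f (h x) else d) (Pi_pmf B e p) =
         Pi_pmf A d (\<lambda>x. p (h x))"
proof (rule pmf_eqI)
  fix f
  have fin: "finite A"
    using assms finite_imageD finite_subset by blast
  let ?r = "\<lambda>f x. if x \<in> A then f (h x) else d"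
  show "pmf (map_pmf ?r (Pi_pmf B e p)) f = pmf (Pi_pmf A d (\<lambda>x. p (h x))) f"
  proof (cases "\<forall>x. x \<notin> A \<longrightarrow> f x = d")
    case True
    \<comment> \<open>The preimage of \<open>f\<close> is a box: coordinates in the image of
      \<open>h\<close> are pinned to one value and all others are free, hence contribute a factor
      1.\<close>
    let ?V = "\<lambda>y. if y \<in> h ` A then {f (the_inv_into A h y)} else UNIV"
    have "?r -` {f} = Pi B ?V"
    proof (intro set_eqI iffI)
      fix g assume "g \<in> ?r -` {f}"
      then have "g (h x) = f x" if "x \<in> A" for x
        using that by (auto simp: fun_eq_iff split: if_splits)
      then show "g \<in> Pi B ?V"
        using assms by (auto simp: Pi_def the_inv_into_f_f)
    next
      fix g assume g: "g \<in> Pi B ?V"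
      have "g (h x) = f x" if "x \<in> A" for x
      proof -
        have "g (h x) \<in> ?V (h x)"
          using g assms that by blast
        then show ?thesis
          using that assms by (auto simp: the_inv_into_f_f)
      qed
      then show "g \<in> ?r -` {f}"
        using True by (auto simp: fun_eq_iff)
    qed
    then have "pmf (map_pmf ?r (Pi_pmf B e p)) f = (\<Prod>y\<in>B. measure_pmf.prob (p y) (?V y))"
      using assms by (simp add: pmf_map measure_Pi_pmf_Pi)
    also have "\<dots> = (\<Prod>y\<in>h ` A. measure_pmf.prob (p y) (?V y))"
      using assms by (intro prod.mono_neutral_right) auto
    also have "\<dots> = (\<Prod>x\<in>A. pmf (p (h x)) (f x))"
      using assms by (subst prod.reindex) (auto simp: the_inv_into_f_f measure_pmf_single)
    also have "\<dots> = pmf (Pi_pmf A d (\<lambda>x. p (h x))) f"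
      using True fin by (simp add: pmf_Pi')
    finally show ?thesis .
  next
    case False
    then have "?r -` {f} = {}"
      by auto
    then show ?thesis
      using False fin by (auto simp: pmf_map pmf_Pi)
  qed
qed

text \<open>Pairwise independence of codewords is all that the union bound needs: it compares the
  sent codeword with one other at a time.\<close>

lemma map_pmf_two_components_Pi_pmf:
  assumes "finite A" "x \<in> A" "y \<in> A" "x \<noteq> y"
  shows "map_pmf (\<lambda>f. (f x, f y)) (Pi_pmf A d p) = pair_pmf (p x) (p y)"
proof -
  have "Pi_pmf A d p = map_pmf (\<lambda>(v, f). f(x := v)) (pair_pmf (p x) (Pi_pmf (A - {x}) d p))"
    using Pi_pmf_insert[of "A - {x}" x d p] assms by (simp add: insert_absorb)
  then have "map_pmf (\<lambda>f. (f x, f y)) (Pi_pmf A d p) =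
             map_pmf (apsnd (\<lambda>f. f y)) (pair_pmf (p x) (Pi_pmf (A - {x}) d p))"
    using assms by (simp add: map_pmf_comp case_prod_beta' apsnd_def map_prod_def)
  also have "\<dots> = pair_pmf (p x) (p y)"
    using assms by (simp add: pair_map_pmf2[symmetric] Pi_pmf_component)
  finally show ?thesis .
qed

section \<open>Averaging over one of two independent components, and Markov's inequality\<close>

lemma prob_pair_pmf:
  "measure_pmf.prob (pair_pmf p q) A =
   measure_pmf.expectation p (\<lambda>x. measure_pmf.prob q {y. (x, y) \<in> A})"
proof -
  have "ennreal (measure_pmf.prob (pair_pmf p q) A) =
        (\<integral>\<^sup>+x. \<integral>\<^sup>+y. indicator A (x, y) \<partial>q \<partial>p)"
    by (simp add: measure_pmf.emeasure_eq_measure[symmetric] nn_integral_pair_pmf'[symmetric])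
  also have "\<dots> = (\<integral>\<^sup>+x. ennreal (measure_pmf.prob q {y. (x, y) \<in> A}) \<partial>p)"
  proof (intro nn_integral_cong)
    fix x
    have "(\<integral>\<^sup>+y. indicator A (x, y) \<partial>q) = (\<integral>\<^sup>+y. indicator {y. (x, y) \<in> A} y \<partial>q)"
      by (intro nn_integral_cong) (simp add: indicator_def)
    then show "(\<integral>\<^sup>+y. indicator A (x, y) \<partial>q) = ennreal (measure_pmf.prob q {y. (x, y) \<in> A})"
      by (simp add: measure_pmf.emeasure_eq_measure)
  qed
  also have "\<dots> = ennreal (measure_pmf.expectation p (\<lambda>x. measure_pmf.prob q {y. (x, y) \<in> A}))"
    by (intro nn_integral_eq_integral measure_pmf.integrable_const_bound[where B = 1]) auto
  finally show ?thesis
    by (simp add: integral_nonneg_AE)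
qed

lemma prob_pair_pmf_swap:
  "measure_pmf.prob (pair_pmf p q) A =
   measure_pmf.expectation q (\<lambda>y. measure_pmf.prob p {x. (x, y) \<in> A})"
  by (subst pair_commute_pmf) (simp add: prob_pair_pmf vimage_def case_prod_beta)

lemma expectation_prob_le:
  assumes "\<And>x. x \<in> set_pmf p \<Longrightarrow> measure_pmf.prob q (A x) \<le> c"
  shows "measure_pmf.expectation p (\<lambda>x. measure_pmf.prob q (A x)) \<le> c"
proof -
  have "measure_pmf.expectation p (\<lambda>x. measure_pmf.prob q (A x)) \<le> measure_pmf.expectation p (\<lambda>x. c)"
    using assms
    by (intro integral_mono_AE measure_pmf.integrable_const_bound[where B = 1 and f = "\<lambda>x. measure_pmf.prob q (A x)"])
       (auto simp: AE_measure_pmf_iff)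
  then show ?thesis by simp
qed

text \<open>The averaging step of random coding: if every section exceeded \<open>c\<close>, so
  would their mean. With \<open>x\<close> a codebook, some fixed codebook is as good as the
  average.\<close>

lemma ex_prob_section_le:
  assumes "measure_pmf.prob (pair_pmf p q) A \<le> c"
  shows "\<exists>x. measure_pmf.prob q {y. (x, y) \<in> A} \<le> c"
proof (rule ccontr)
  let ?g = "\<lambda>x. measure_pmf.prob q {y. (x, y) \<in> A}"
  assume "\<not> ?thesis"
  then have gt: "?g x > c" for x
    by (simp add: not_le)
  have "measure_pmf.expectation p (\<lambda>x. c) < measure_pmf.expectation p ?g"
    using gt
    by (intro measure_pmf.integral_less_AE_space measure_pmf.integrable_const_bound[where B = 1 and f = ?g]) auto
  with assms show False
    by (simp add: prob_pair_pmf)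
qed

lemma finite_set_Pi_pmf:
  assumes "finite A" "\<And>x. x \<in> A \<Longrightarrow> finite (set_pmf (p x))"
  shows "finite (set_pmf (Pi_pmf A d p))"
  using assms by (simp add: set_Pi_pmf finite_PiE_dflt)

lemma prob_le_expectation_div:
  fixes f :: "'a \<Rightarrow> real"
  assumes "finite (set_pmf p)" "\<And>x. x \<in> set_pmf p \<Longrightarrow> 0 \<le> f x" "c > 0"
  shows "measure_pmf.prob p {x. f x \<ge> c} \<le> measure_pmf.expectation p f / c"
proof -
  have "c * measure_pmf.prob p {x. f x \<ge> c} =
        measure_pmf.expectation p (\<lambda>x. c * indicator {x. f x \<ge> c} x)"
    by simp
  also have "\<dots> \<le> measure_pmf.expectation p f"
    using assms
    by (intro integral_mono_AE integrable_measure_pmf_finite)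
       (auto simp: AE_measure_pmf_iff indicator_def)
  finally show ?thesis
    using assms by (simp add: field_simps)
qed

subsection \<open>Random coding\<close>

text \<open>If the sent codeword passes the test \<open>T\<close> and no other one does, the choice
  is forced and correct. A wrong codeword is independent of the sent one and of the noise, hence of
  the received word, so \<open>\<beta>\<close> applies to each of the \<open>M - 1\<close> wrong
  candidates.\<close>

lemma random_coding_union_bound:
  fixes Q :: "'x pmf" and N :: "'n pmf" and g :: "'x \<Rightarrow> 'n \<Rightarrow> 'y"
  assumes miss: "measure_pmf.prob (pair_pmf Q N) {(x, n). \<not> T x (g x n)} \<le> \<alpha>"
    and false: "\<And>y. measure_pmf.prob Q {x. T x y} \<le> \<beta>"
    and w: "w < M"
  shows "measure_pmf.prob (pair_pmf (Pi_pmf {..<M} d (\<lambda>_. Q)) N)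
           {(C, n). (SOME v. v < M \<and> T (C v) (g (C w) n)) \<noteq> w} \<le> \<alpha> + (real M - 1) * \<beta>"
proof -
  let ?P = "pair_pmf (Pi_pmf {..<M} d (\<lambda>_. Q)) N"
  let ?A = "{(C, n). \<not> T (C w) (g (C w) n)}"
  let ?B = "\<lambda>v. {(C, n). T (C v) (g (C w) n)}"
  have sub: "{(C, n). (SOME v. v < M \<and> T (C v) (g (C w) n)) \<noteq> w} \<subseteq>
        ?A \<union> (\<Union>v\<in>{..<M} - {w}. ?B v)"
  proof clarsimp
    fix C n
    assume ne: "(SOME v. v < M \<and> T (C v) (g (C w) n)) \<noteq> w"
      and nb: "\<forall>v\<in>{..<M} - {w}. \<not> T (C v) (g (C w) n)"
      and t: "T (C w) (g (C w) n)"
    have "(SOME v. v < M \<and> T (C v) (g (C w) n)) = w"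
      using t w nb by (intro some_equality) auto
    with ne show False by simp
  qed
  have "measure_pmf.prob ?P ?A \<le> \<alpha>"
  proof -
    have "map_pmf (\<lambda>(C, n). (C w, n)) ?P = pair_pmf Q N"
      using map_pair[of "\<lambda>C. C w" "\<lambda>n. n" "Pi_pmf {..<M} d (\<lambda>_. Q)" N] w
      by (simp add: Pi_pmf_component)
    then have "measure_pmf.prob (pair_pmf Q N) {(x, n). \<not> T x (g x n)} =
               measure_pmf.prob ?P ((\<lambda>(C, n). (C w, n)) -` {(x, n). \<not> T x (g x n)})"
      using measure_map_pmf[of "\<lambda>(C, n). (C w, n)" ?P "{(x, n). \<not> T x (g x n)}"] by simp
    with miss show ?thesis
      by (simp add: vimage_def case_prod_beta')
  qed
  moreover have "measure_pmf.prob ?P (?B v) \<le> \<beta>" if v: "v \<in> {..<M} - {w}" for v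
  proof -
    \<comment> \<open>With the noise fixed, conditioning on the sent codeword fixes the received
      word, while \<open>C v\<close> still has law \<open>Q\<close>.\<close>
    have "measure_pmf.prob (Pi_pmf {..<M} d (\<lambda>_. Q)) {C. T (C v) (g (C w) n)} \<le> \<beta>" for n
    proof -
      have "map_pmf (\<lambda>C. (C w, C v)) (Pi_pmf {..<M} d (\<lambda>_. Q)) = pair_pmf Q Q"
        using v w by (intro map_pmf_two_components_Pi_pmf) auto
      then have "measure_pmf.prob (Pi_pmf {..<M} d (\<lambda>_. Q))
                   ((\<lambda>C. (C w, C v)) -` {(x, x'). T x' (g x n)}) =
                 measure_pmf.prob (pair_pmf Q Q) {(x, x'). T x' (g x n)}"
        using measure_map_pmf[of "\<lambda>C. (C w, C v)" "Pi_pmf {..<M} d (\<lambda>_. Q)" "{(x, x'). T x' (g x n)}"]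
        by simp
      also have "\<dots> \<le> \<beta>"
        unfolding prob_pair_pmf using false by (intro expectation_prob_le) auto
      finally show ?thesis
        by (simp add: vimage_def)
    qed
    then show ?thesis
      unfolding prob_pair_pmf_swap by (intro expectation_prob_le) auto
  qed
  then have "(\<Sum>v\<in>{..<M} - {w}. measure_pmf.prob ?P (?B v)) \<le> (real M - 1) * \<beta>"
    using sum_bounded_above[of "{..<M} - {w}" "\<lambda>v. measure_pmf.prob ?P (?B v)" \<beta>] w
    by (simp add: of_nat_diff)
  moreover have "measure_pmf.prob ?P (\<Union>v\<in>{..<M} - {w}. ?B v) \<le>
      (\<Sum>v\<in>{..<M} - {w}. measure_pmf.prob ?P (?B v))"
    by (intro measure_pmf.finite_measure_subadditive_finite) auto
  moreover have "measure_pmf.prob ?P {(C, n). (SOME v. v < M \<and> T (C v) (g (C w) n)) \<noteq> w} \<le>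
      measure_pmf.prob ?P (?A \<union> (\<Union>v\<in>{..<M} - {w}. ?B v))"
    using sub by (intro measure_pmf.finite_measure_mono) auto
  moreover have "measure_pmf.prob ?P (?A \<union> (\<Union>v\<in>{..<M} - {w}. ?B v)) \<le>
      measure_pmf.prob ?P ?A + measure_pmf.prob ?P (\<Union>v\<in>{..<M} - {w}. ?B v)"
    by (intro measure_Un_le) auto
  ultimately show ?thesis
    by linarith
qed

section \<open>Threshold decoding over a memoryless channel\<close>

lemma log_prod_pos:
  fixes f :: "'a \<Rightarrow> real"
  assumes "finite I" "\<And>i. i \<in> I \<Longrightarrow> 0 < f i"
  shows "log b (prod f I) = (\<Sum>i\<in>I. log b (f i))"
proof -
  have "ln (prod f I) = (\<Sum>i\<in>I. ln (f i))"
    using assms by (intro ln_prod) force+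
  then show ?thesis
    by (simp add: log_def sum_divide_distrib)
qed

text \<open>As a function of \<open>t\<close>, the expectation is 1 at 0 and has derivative minus
  the mean of \<open>X\<close> there, which is negative; so it drops below 1 just to the right of 0.
  This supplies the exponent of the Chernoff bound.\<close>

lemma ex_expectation_exp_less_1:
  fixes X :: "'a \<Rightarrow> real"
  assumes fin: "finite (set_pmf p)" and pos: "measure_pmf.expectation p X > 0"
  shows "\<exists>t>0. measure_pmf.expectation p (\<lambda>x. exp (- t * X x)) < 1"
proof -
  define g where "g t = (\<Sum>x\<in>set_pmf p. pmf p x * exp (- t * X x))" for t
  have g: "measure_pmf.expectation p (\<lambda>x. exp (- t * X x)) = g t" for t
    using fin by (subst integral_measure_pmf_real[where A = "set_pmf p"]) (auto simp: g_def mult.commute)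
  have "measure_pmf.expectation p X = (\<Sum>x\<in>set_pmf p. pmf p x * X x)"
    using fin by (subst integral_measure_pmf_real[where A = "set_pmf p"]) (auto simp: mult.commute)
  moreover have "DERIV g 0 :> (\<Sum>x\<in>set_pmf p. pmf p x * (- X x))"
    unfolding g_def by (auto intro!: derivative_eq_intros sum.cong)
  ultimately have "DERIV g 0 :> - measure_pmf.expectation p X"
    by (simp add: sum_negf)
  then obtain e where e: "e > 0" "\<And>h. h > 0 \<Longrightarrow> h < e \<Longrightarrow> g (0 + h) < g 0"
    using DERIV_neg_dec_right[of g "- measure_pmf.expectation p X" 0] pos by auto
  have "g 0 = 1"
    using g[of 0] by simp
  then show ?thesis
    using e(2)[of "e / 2"] e(1) g[of "e / 2"] by (intro exI[of _ "e / 2"]) auto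
qed

text \<open>With \<open>r\<close> a likelihood ratio of one letter, the product is the ratio for the
  whole word. If no index or several indices pass, the choice is arbitrary, and the analysis counts
  this as an error.\<close>

definition threshold_decoder ::
    "('a \<Rightarrow> 'b \<Rightarrow> real) \<Rightarrow> real \<Rightarrow> nat \<Rightarrow> nat \<Rightarrow> (nat \<Rightarrow> nat \<Rightarrow> 'a) \<Rightarrow> (nat \<Rightarrow> 'b) \<Rightarrow> nat"
  where "threshold_decoder r \<theta> m M C y =
    (SOME w. w < M \<and> (\<Prod>s<m. r (C w s) (y s)) > 2 powr (real m * \<theta>))"

lemma threshold_decoder_cong:
  assumes "\<And>s. s < m \<Longrightarrow> y s = y' s"
  shows "threshold_decoder r \<theta> m M C y = threshold_decoder r \<theta> m M C y'"
  using assms by (simp add: threshold_decoder_def)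

text \<open>Here \<open>r a y\<close> stands for the conditional probability of output
  \<open>y\<close> given \<open>a\<close>, divided by the output probability. Its mean of at most 1
  over random inputs controls wrong codewords; the mean of its logarithm is the information, which
  controls the sent one. The bound \<open>\<beta>\<close> is uniform in \<open>M\<close> and
  \<open>w\<close>.\<close>

lemma random_coding:
  fixes P :: "'a pmf" and \<nu> :: "'c pmf" and f :: "'a \<Rightarrow> 'c \<Rightarrow> 'b" and r :: "'a \<Rightarrow> 'b \<Rightarrow> real"
  assumes finP: "finite (set_pmf P)" and fin\<nu>: "finite (set_pmf \<nu>)"
    and nonneg: "\<And>a y. 0 \<le> r a y"
    and pos: "\<And>a n. a \<in> set_pmf P \<Longrightarrow> n \<in> set_pmf \<nu> \<Longrightarrow> 0 < r a (f a n)"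
    and le1: "\<And>y. measure_pmf.expectation P (\<lambda>a. r a y) \<le> 1"
    and info: "R' < measure_pmf.expectation (pair_pmf P \<nu>) (\<lambda>(a, n). log 2 (r a (f a n)))"
  shows "\<exists>\<theta> \<beta>. \<beta> \<longlonglongrightarrow> 0 \<and> (\<forall>m M w. real M \<le> 2 powr (real m * R') + 1 \<longrightarrow> w < M \<longrightarrow>
     measure_pmf.prob (pair_pmf (Pi_pmf {..<M} (\<lambda>_. d) (\<lambda>_. Pi_pmf {..<m} d (\<lambda>_. P)))
       (Pi_pmf {..<m} e (\<lambda>_. \<nu>)))
       {(C, n). threshold_decoder r \<theta> m M C (\<lambda>s. f (C w s) (n s)) \<noteq> w} \<le> \<beta> m)"
proof -
  define I where "I = measure_pmf.expectation (pair_pmf P \<nu>) (\<lambda>(a, n). log 2 (r a (f a n)))"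
  \<comment> \<open>Any value strictly between works: being above \<open>R'\<close> makes the union
    bound decay, being below \<open>I\<close> makes a miss exponentially unlikely.\<close>
  define \<theta> where "\<theta> = (R' + I) / 2"
  have \<theta>: "R' < \<theta>" "\<theta> < I"
    using info unfolding \<theta>_def I_def by auto
  let ?J = "pair_pmf P \<nu>"
  have finJ: "finite (set_pmf ?J)"
    using finP fin\<nu> by simp
  define X where "X = (\<lambda>(a, n). log 2 (r a (f a n)) - \<theta>)"
  have "measure_pmf.expectation ?J X = I - \<theta>"
    using finJ by (simp add: X_def I_def case_prod_beta' integrable_measure_pmf_finite)
  with \<theta> obtain t where t: "t > 0" "measure_pmf.expectation ?J (\<lambda>x. exp (- t * X x)) < 1"
    using ex_expectation_exp_less_1[OF finJ, of X] by auto
  define \<rho> where "\<rho> = measure_pmf.expectation ?J (\<lambda>x. exp (- t * X x))"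
  define \<beta> where "\<beta> m = \<rho> ^ m + (2 powr (R' - \<theta>)) ^ m" for m :: nat
  have \<rho>: "0 \<le> \<rho>" "\<rho> < 1"
    using t by (auto simp: \<rho>_def intro!: integral_nonneg_AE)
  have "2 powr (R' - \<theta>) < 1"
    using \<theta> powr_less_mono[of "R' - \<theta>" 0 2] by simp
  then have "\<beta> \<longlonglongrightarrow> 0 + 0"
    unfolding \<beta>_def using \<rho> by (intro tendsto_add LIMSEQ_power_zero) auto
  moreover have "measure_pmf.prob (pair_pmf (Pi_pmf {..<M} (\<lambda>_. d) (\<lambda>_. Pi_pmf {..<m} d (\<lambda>_. P)))
       (Pi_pmf {..<m} e (\<lambda>_. \<nu>)))
       {(C, n). threshold_decoder r \<theta> m M C (\<lambda>s. f (C w s) (n s)) \<noteq> w} \<le> \<beta> m"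
    if M: "real M \<le> 2 powr (real m * R') + 1" and w: "w < M" for m M w
  proof -
    let ?Q = "Pi_pmf {..<m} d (\<lambda>_. P)"
    let ?N = "Pi_pmf {..<m} e (\<lambda>_. \<nu>)"
    let ?T = "\<lambda>x y. (\<Prod>s<m. r (x s) (y s)) > 2 powr (real m * \<theta>)"
    let ?g = "\<lambda>x n s. f (x s) (n s)"
    have finQ: "finite (set_pmf ?Q)"
      using finP by (intro finite_set_Pi_pmf) auto
    have finN: "finite (set_pmf ?N)"
      using fin\<nu> by (intro finite_set_Pi_pmf) auto
    have false: "measure_pmf.prob ?Q {x. ?T x y} \<le> 2 powr (- (real m * \<theta>))" for y
    proof -
      have "measure_pmf.prob ?Q {x. ?T x y} \<le>
            measure_pmf.prob ?Q {x. (\<Prod>s<m. r (x s) (y s)) \<ge> 2 powr (real m * \<theta>)}"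
        by (intro measure_pmf.finite_measure_mono) auto
      also have "\<dots> \<le> measure_pmf.expectation ?Q (\<lambda>x. \<Prod>s<m. r (x s) (y s)) / 2 powr (real m * \<theta>)"
        using finQ nonneg by (intro prob_le_expectation_div) (auto intro!: prod_nonneg)
      also have "measure_pmf.expectation ?Q (\<lambda>x. \<Prod>s<m. r (x s) (y s)) =
          (\<Prod>s<m. measure_pmf.expectation P (\<lambda>a. r a (y s)))"
        using finP nonneg by (intro expectation_prod_Pi_pmf) (auto intro!: integrable_measure_pmf_finite)
      also have "\<dots> \<le> 1"
        using le1 nonneg by (intro prod_le_1) (auto intro!: integral_nonneg_AE)
      finally show ?thesis
        by (simp add: powr_minus divide_simps)
    qed
    have miss: "measure_pmf.prob (pair_pmf ?Q ?N) {(x, n). \<not> ?T x (?g x n)} \<le> \<rho> ^ m"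
    proof -
      let ?Z = "Pi_pmf {..<m} (d, e) (\<lambda>_. ?J)"
      have finZ: "finite (set_pmf ?Z)"
        using finJ by (intro finite_set_Pi_pmf) auto
      let ?h = "\<lambda>(x, n) s. (x s, n s)"
      have Z: "?Z = map_pmf ?h (pair_pmf ?Q ?N)"
        by (simp add: map_pmf_pair_Pi_pmf)
      have "measure_pmf.prob (pair_pmf ?Q ?N) {(x, n). \<not> ?T x (?g x n)} =
        measure_pmf.prob ?Z
          {z. \<not> (\<Prod>s<m. r (fst (z s)) (f (fst (z s)) (snd (z s)))) > 2 powr (real m * \<theta>)}"
        unfolding Z by (simp add: vimage_def case_prod_beta')
      \<comment> \<open>On the support all ratios are positive, so logarithms turn a failed test
        into a nonpositive sum of the \<open>X (z s)\<close>. Multiplying by \<open>- t\<close> and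
        exponentiating gives a product of at least 1, ready for Markov's inequality.\<close>
      also have "\<dots> \<le> measure_pmf.prob ?Z {z. 1 \<le> (\<Prod>s<m. exp (- t * X (z s)))}"
      proof (rule measure_pmf.finite_measure_mono_AE, unfold AE_measure_pmf_iff, intro ballI impI)
        fix z
        assume z: "z \<in> set_pmf ?Z"
          and le: "z \<in> {z. \<not> (\<Prod>s<m. r (fst (z s)) (f (fst (z s)) (snd (z s)))) > 2 powr (real m * \<theta>)}"
        have rpos: "0 < r (fst (z s)) (f (fst (z s)) (snd (z s)))" if "s < m" for s
          using z that by (auto simp: set_Pi_pmf PiE_dflt_def intro!: pos)
        then have "(\<Sum>s<m. log 2 (r (fst (z s)) (f (fst (z s)) (snd (z s))))) =
             log 2 (\<Prod>s<m. r (fst (z s)) (f (fst (z s)) (snd (z s))))"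
          by (subst log_prod_pos) auto
        also have "\<dots> \<le> log 2 (2 powr (real m * \<theta>))"
          using le rpos by (subst log_le_cancel_iff) (auto intro!: prod_pos)
        finally have "(\<Sum>s<m. X (z s)) \<le> 0"
          by (simp add: X_def case_prod_beta sum_subtractf)
        then have "0 \<le> (\<Sum>s<m. - t * X (z s))"
          using t by (simp add: sum_distrib_left[symmetric] sum_negf mult_nonneg_nonpos)
        then show "z \<in> {z. 1 \<le> (\<Prod>s<m. exp (- t * X (z s)))}"
          by (simp add: exp_sum[symmetric])
      qed auto
      also have "\<dots> \<le> measure_pmf.expectation ?Z (\<lambda>z. \<Prod>s<m. exp (- t * X (z s))) / 1"
        using finZ by (intro prob_le_expectation_div) (auto intro!: prod_nonneg)
      also have "\<dots> = (\<Prod>s<m. \<rho>)"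
        unfolding \<rho>_def div_by_1 using finJ
        by (intro expectation_prod_Pi_pmf integrable_measure_pmf_finite) auto
      finally show ?thesis
        by simp
    qed
    have "measure_pmf.prob (pair_pmf (Pi_pmf {..<M} (\<lambda>_. d) (\<lambda>_. ?Q)) ?N)
       {(C, n). threshold_decoder r \<theta> m M C (\<lambda>s. f (C w s) (n s)) \<noteq> w} \<le>
        \<rho> ^ m + (real M - 1) * 2 powr (- (real m * \<theta>))"
      unfolding threshold_decoder_def
      by (rule random_coding_union_bound[where g = ?g and T = ?T, OF miss false w])
    \<comment> \<open>The slack \<open>+ 1\<close> in the hypothesis on \<open>M\<close>, which
      leaves room for rounding up, is absorbed because only \<open>M - 1\<close> codewords are
      wrong.\<close>
    also have "(real M - 1) * 2 powr (- (real m * \<theta>)) \<le> 2 powr (real m * R') * 2 powr (- (real m * \<theta>))"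
      using M by (intro mult_right_mono) auto
    also have "\<dots> = (2 powr (R' - \<theta>)) ^ m"
      by (simp add: powr_realpow[symmetric] powr_powr powr_add[symmetric] algebra_simps)
    finally show ?thesis
      by (simp add: \<beta>_def)
  qed
  ultimately show ?thesis
    by (intro exI[of _ \<theta>] exI[of _ \<beta>]) auto
qed

subsection \<open>Information of binary symmetric channels\<close>

text \<open>The derivative \<open>log 2 (1 - q) - log 2 q\<close> is nonnegative up to 1/2. It does
  not exist at 0, so \<open>a = 0\<close> is treated apart: there the entropy is 0, and both terms
  of the entropy at \<open>b\<close> are nonnegative.\<close>

lemma bin_entropy_mono:
  assumes "0 \<le> a" "a \<le> b" "b \<le> 1 / 2"
  shows "bin_entropy a \<le> bin_entropy b"
proof (cases "a = 0")
  case True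
  have "log 2 b \<le> 0" if "b > 0"
    using that assms by (simp add: log_le_zero_cancel_iff)
  then have "b * log 2 b \<le> 0"
    using assms by (cases "b = 0") (auto simp: mult_nonneg_nonpos)
  moreover have "(1 - b) * log 2 (1 - b) \<le> 0"
    using assms by (intro mult_nonneg_nonpos) (auto simp: log_le_zero_cancel_iff)
  ultimately show ?thesis
    using True by (simp add: bin_entropy_def)
next
  case False
  with assms have "0 < a" by simp
  show ?thesis
  proof (rule DERIV_nonneg_imp_nondecreasing[OF assms(2)])
    fix q assume q: "a \<le> q" "q \<le> b"
    with \<open>0 < a\<close> assms have q': "0 < q" "q \<le> 1 / 2" by auto
    then have "(bin_entropy has_real_derivative log 2 (1 - q) - log 2 q) (at q)"
      unfolding bin_entropy_def[abs_def] log_def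
      by (auto intro!: derivative_eq_intros simp: divide_simps)
    moreover have "0 \<le> log 2 (1 - q) - log 2 q"
      using q' by simp
    ultimately show "\<exists>y. (bin_entropy has_real_derivative y) (at q) \<and> 0 \<le> y"
      by blast
  qed
qed

lemma expectation_pmf_of_set_bool:
  "measure_pmf.expectation (pmf_of_set (UNIV :: bool set)) f = (f True + f False) / (2 :: real)"
  by (subst integral_pmf_of_set) (auto simp: UNIV_bool)

text \<open>A binary symmetric channel with uniform input has uniform output, so twice the
  probability of the noise bit is its likelihood ratio, and the mean logarithm is its
  capacity.\<close>

lemma expectation_log_bernoulli:
  assumes "0 \<le> q" "q \<le> 1"
  shows "measure_pmf.expectation (bernoulli_pmf q) (\<lambda>b. log 2 (2 * pmf (bernoulli_pmf q) b)) =
         1 - bin_entropy q"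
proof -
  have "x * log 2 (2 * x) = x + x * log 2 x" if "0 \<le> x" for x :: real
    using that by (cases "x = 0") (auto simp: log_mult algebra_simps)
  from this[of q] this[of "1 - q"] show ?thesis
    using assms by (simp add: bin_entropy_def mult.commute)
qed

lemma pmf_bernoulli_True_plus_False:
  "pmf (bernoulli_pmf q) True + pmf (bernoulli_pmf q) False = 1"
  using sum_pmf_eq_1[OF _ subset_UNIV, of "bernoulli_pmf q"] by (simp add: UNIV_bool add.commute)

section \<open>The channel from one source bit to the outputs of the repeating relays\<close>

definition likelihood :: "(nat \<Rightarrow> real) \<Rightarrow> nat set \<Rightarrow> bool \<Rightarrow> (nat \<Rightarrow> bool) \<Rightarrow> real"
  where "likelihood p F u y = (\<Prod>i\<in>F. pmf (bernoulli_pmf (p i)) (y i \<oplus> u))"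

text \<open>The denominator is the output law for a uniform input bit, so this is the information
  density of the channel. At outputs that neither input can produce, division by zero makes it
  0.\<close>

definition likelihood_ratio :: "(nat \<Rightarrow> real) \<Rightarrow> nat set \<Rightarrow> bool \<Rightarrow> (nat \<Rightarrow> bool) \<Rightarrow> real"
  where "likelihood_ratio p F u y =
    likelihood p F u y / ((likelihood p F True y + likelihood p F False y) / 2)"

lemma likelihood_nonneg: "0 \<le> likelihood p F u y"
  by (simp add: likelihood_def prod_nonneg)

lemma likelihood_ratio_nonneg: "0 \<le> likelihood_ratio p F u y"
  by (simp add: likelihood_ratio_def likelihood_nonneg)

lemma likelihood_ratio_pos:
  assumes "0 < likelihood p F u y"
  shows "0 < likelihood_ratio p F u y"
proof -
  have "0 < likelihood p F True y + likelihood p F False y"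
    using assms likelihood_nonneg[of p F True y] likelihood_nonneg[of p F False y] by (cases u) auto
  with assms show ?thesis
    by (simp add: likelihood_ratio_def)
qed

lemma likelihood_cong: "(\<And>i. i \<in> F \<Longrightarrow> y i = y' i) \<Longrightarrow> likelihood p F u y = likelihood p F u y'"
  by (simp add: likelihood_def cong: prod.cong)

lemma likelihood_ratio_cong:
  "(\<And>i. i \<in> F \<Longrightarrow> y i = y' i) \<Longrightarrow> likelihood_ratio p F u y = likelihood_ratio p F u y'"
  using likelihood_cong[of F y y' p] by (simp add: likelihood_ratio_def)

text \<open>The mean is 1 except at outputs that neither input can produce, where it is 0; hence an
  inequality.\<close>

lemma expectation_likelihood_ratio_le_1:
  "measure_pmf.expectation (pmf_of_set UNIV) (\<lambda>u. likelihood_ratio p F u y) \<le> 1"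
proof -
  let ?s = "likelihood p F True y + likelihood p F False y"
  have "measure_pmf.expectation (pmf_of_set UNIV) (\<lambda>u. likelihood_ratio p F u y) = ?s / ?s"
    by (simp add: expectation_pmf_of_set_bool likelihood_ratio_def add_divide_distrib)
  then show ?thesis by simp
qed

text \<open>All alphabets are finite, so the mutual information is a sum over values. The joint law
  is half the likelihood, and dividing it by the product of the marginals gives exactly
  \<open>likelihood_ratio\<close>.\<close>

lemma fwd_information_eq:
  assumes "finite F"
  shows "fwd_information p F =
    measure_pmf.expectation (fwd_pmf p F) (\<lambda>x. log 2 (likelihood_ratio p F (fst x) (fwd_output F x)))"
proof -
  interpret information_space "measure_pmf (fwd_pmf p F)" 2
    by unfold_locales simp
  let ?M = "measure_pmf (fwd_pmf p F)"
  let ?Y = "fwd_output F"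
  let ?XY = "\<lambda>x. (fst x, ?Y x)"
  let ?R = "F \<rightarrow>\<^sub>E (UNIV :: bool set)"
  \<comment> \<open>The library formula sums over the image of the whole space. Every pair occurs in
    it: the noise \<open>u \<oplus> y i\<close> turns \<open>u\<close> into
    \<open>y\<close>.\<close>
  have range: "range ?XY = UNIV \<times> ?R"
  proof (intro equalityI subsetI)
    fix z :: "bool \<times> (nat \<Rightarrow> bool)" assume "z \<in> UNIV \<times> ?R"
    then have "z = ?XY (fst z, \<lambda>i. fst z \<oplus> snd z i)"
      by (auto simp: fwd_output_def prod_eq_iff fun_eq_iff restrict_def PiE_def extensional_def)
    then show "z \<in> range ?XY" by blast
  qed (auto simp: fwd_output_def)
  have rangeY: "range ?Y = ?R"
    using arg_cong[OF range, of "image snd"] by (simp add: image_image image_comp)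
  have finR: "finite ?R"
    using assms by (intro finite_PiE) auto
  have joint: "measure_pmf.prob (fwd_pmf p F) {x. ?XY x = (u, y)} = likelihood p F u y / 2"
    if "y \<in> ?R" for u y
  proof -
    \<comment> \<open>Once the input is \<open>u\<close>, the output determines the noise on
      \<open>F\<close> and leaves it free elsewhere, so the event is a box.\<close>
    have "{N. ?XY (v, N) = (u, y)} = (if v = u then Pi F (\<lambda>i. {y i \<oplus> u}) else {})" for v
      using that by (auto simp: fwd_output_def fun_eq_iff restrict_def PiE_def extensional_def Pi_def)
    then have "measure_pmf.prob (Pi_pmf F False (\<lambda>i. bernoulli_pmf (p i))) {N. ?XY (v, N) = (u, y)} =
        (if v = u then likelihood p F u y else 0)" for v
      using assms by (auto simp: measure_Pi_pmf_Pi likelihood_def measure_pmf_single simp del: prod.inject)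
    then show ?thesis
      unfolding fwd_pmf_def prob_pair_pmf mem_Collect_eq
      by (simp add: expectation_pmf_of_set_bool del: prod.inject)
  qed
  define PXY where "PXY = (\<lambda>(u, y). likelihood p F u y / 2)"
  define PY where "PY y = (likelihood p F True y + likelihood p F False y) / 2" for y
  have X: "simple_distributed ?M fst (\<lambda>_. 1 / 2)"
  proof (rule measure_pmf.simple_distributedI)
    fix u :: bool
    have "measure_pmf.prob (fwd_pmf p F) (fst -` {u}) = pmf (pmf_of_set UNIV) u"
      unfolding fwd_pmf_def pmf_map[symmetric] map_fst_pair_pmf ..
    then show "1 / 2 = measure ?M (fst -` {u} \<inter> space ?M)"
      by simp
  qed (auto simp: simple_function_def)
  have Y: "simple_distributed ?M ?Y PY"
  proof (rule measure_pmf.simple_distributedI)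
    fix y assume "y \<in> ?Y ` space ?M"
    then have y: "y \<in> ?R" using rangeY by simp
    have "?Y -` {y} \<inter> space ?M = {x. ?XY x = (True, y)} \<union> {x. ?XY x = (False, y)}"
      by auto
    also have "measure ?M \<dots> = PY y"
      by (subst measure_pmf.finite_measure_Union) (auto simp: joint[OF y] PY_def add_divide_distrib simp del: prod.inject)
    finally show "PY y = measure ?M (?Y -` {y} \<inter> space ?M)" ..
  qed (use finR rangeY in \<open>auto simp: simple_function_def PY_def likelihood_nonneg\<close>)
  have XY: "simple_distributed ?M ?XY PXY"
  proof (rule measure_pmf.simple_distributedI)
    fix z assume "z \<in> ?XY ` space ?M"
    then have "z \<in> UNIV \<times> ?R"
      unfolding range[symmetric] by simp
    then have "snd z \<in> ?R" by auto
    then show "PXY z = measure ?M (?XY -` {z} \<inter> space ?M)"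
      using joint[of "snd z" "fst z"] by (simp add: PXY_def case_prod_beta vimage_def del: prod.inject)
  qed (use finR range in \<open>auto simp: simple_function_def PXY_def likelihood_nonneg\<close>)
  have "prob_space.mutual_information ?M 2 (count_space (fst ` space ?M)) (count_space (?Y ` space ?M)) fst ?Y =
      (\<Sum>(u, y)\<in>?XY ` space ?M. PXY (u, y) * log 2 (PXY (u, y) / (1 / 2 * PY y)))"
    by (rule mutual_information_simple_distributed[OF X Y XY])
  moreover have "fst ` (UNIV :: (bool \<times> (nat \<Rightarrow> bool)) set) = UNIV"
    by simp
  ultimately have "fwd_information p F =
      (\<Sum>(u, y)\<in>UNIV \<times> ?R. PXY (u, y) * log 2 (PXY (u, y) / (1 / 2 * PY y)))"
    unfolding fwd_information_def using range rangeY by simp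
  also have "\<dots> = (\<Sum>z\<in>UNIV \<times> ?R. log 2 (likelihood_ratio p F (fst z) (snd z)) *
      pmf (map_pmf ?XY (fwd_pmf p F)) z)"
  proof (intro sum.cong refl, clarify)
    fix u y assume "y \<in> ?R"
    then have "pmf (map_pmf ?XY (fwd_pmf p F)) (u, y) = PXY (u, y)"
      using joint[of y u] by (simp add: pmf_map vimage_def PXY_def del: prod.inject)
    then show "PXY (u, y) * log 2 (PXY (u, y) / (1 / 2 * PY y)) =
        log 2 (likelihood_ratio p F (fst (u, y)) (snd (u, y))) * pmf (map_pmf ?XY (fwd_pmf p F)) (u, y)"
      by (simp add: PXY_def PY_def likelihood_ratio_def mult.commute)
  qed
  also have "\<dots> = measure_pmf.expectation (map_pmf ?XY (fwd_pmf p F))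
      (\<lambda>z. log 2 (likelihood_ratio p F (fst z) (snd z)))"
  proof (rule integral_measure_pmf_real[symmetric])
    fix z assume "z \<in> set_pmf (map_pmf ?XY (fwd_pmf p F))"
    then show "z \<in> UNIV \<times> ?R"
      unfolding range[symmetric] by auto
  qed (use finR in simp)
  also have "\<dots> = measure_pmf.expectation (fwd_pmf p F)
      (\<lambda>x. log 2 (likelihood_ratio p F (fst x) (fwd_output F x)))"
    by simp
  finally show ?thesis .
qed

text \<open>
  A letter of the channel seen by the destination: bit 0 of the input is relayed to all outputs in
  \<open>F\<close>, while output \<open>i \<in> D\<close> carries bit \<open>i\<close> of the input.
\<close>

definition letter_output :: "nat set \<Rightarrow> nat set \<Rightarrow> (nat \<Rightarrow> bool) \<Rightarrow> (nat \<Rightarrow> bool) \<Rightarrow> nat \<Rightarrow> bool"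
  where "letter_output D F a N i = (i \<in> D \<union> F \<and> ((if i \<in> D then a i else a 0) \<oplus> N i))"

text \<open>The bits of a letter are independent and uniform, so the letter channel is a product of
  the channel into \<open>F\<close> and one binary symmetric channel per relay in \<open>D\<close>,
  and its ratio factorises. Relays are numbered from 1, which leaves index 0 for the source
  bit.\<close>

definition letter_ratio ::
    "(nat \<Rightarrow> real) \<Rightarrow> nat set \<Rightarrow> nat set \<Rightarrow> (nat \<Rightarrow> bool) \<Rightarrow> (nat \<Rightarrow> bool) \<Rightarrow> real"
  where "letter_ratio q D F a y =
    likelihood_ratio q F (a 0) y * (\<Prod>i\<in>D. 2 * pmf (bernoulli_pmf (q i)) (y i \<oplus> a i))"

abbreviation letter_pmf :: "nat set \<Rightarrow> (nat \<Rightarrow> bool) pmf"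
  where "letter_pmf D \<equiv> Pi_pmf (insert 0 D) False (\<lambda>_. pmf_of_set UNIV)"

abbreviation bits_pmf :: "nat set \<Rightarrow> (nat \<Rightarrow> real) \<Rightarrow> (nat \<Rightarrow> bool) pmf"
  where "bits_pmf A q \<equiv> Pi_pmf A False (\<lambda>i. bernoulli_pmf (q i))"

lemma letter_ratio_nonneg: "0 \<le> letter_ratio q D F a y"
  by (simp add: letter_ratio_def likelihood_ratio_nonneg prod_nonneg)

text \<open>For fixed \<open>y\<close> the ratio is a product of functions \<open>g k\<close> of
  separate independent bits, so the mean factorises. Each factor with \<open>k\<close> in
  \<open>D\<close> averages to 1, the factor of bit 0 to at most 1.\<close>

lemma expectation_letter_ratio_le_1:
  assumes "finite D" "0 \<notin> D"
  shows "measure_pmf.expectation (letter_pmf D) (\<lambda>a. letter_ratio q D F a y) \<le> 1"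
proof -
  define g where "g k b = (if k = 0 then likelihood_ratio q F b y
      else 2 * pmf (bernoulli_pmf (q k)) (y k \<oplus> b))" for k b
  have "letter_ratio q D F a y = (\<Prod>k\<in>insert 0 D. g k (a k))" for a
  proof -
    have "(\<Prod>k\<in>D. g k (a k)) = (\<Prod>i\<in>D. 2 * pmf (bernoulli_pmf (q i)) (y i \<oplus> a i))"
      using assms by (intro prod.cong) (auto simp: g_def)
    then show ?thesis
      using assms by (simp add: letter_ratio_def g_def)
  qed
  then have "measure_pmf.expectation (letter_pmf D) (\<lambda>a. letter_ratio q D F a y) =
      (\<Prod>k\<in>insert 0 D. measure_pmf.expectation (pmf_of_set UNIV) (g k))"
    using assms by (simp only:, intro expectation_prod_Pi_pmf)
      (auto simp: g_def likelihood_ratio_nonneg intro!: integrable_measure_pmf_finite)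
  also have "\<dots> \<le> 1"
  proof (intro prod_le_1 conjI)
    fix k
    have "measure_pmf.expectation (pmf_of_set UNIV) (g k) = 1" if "k \<noteq> 0"
      using that pmf_bernoulli_True_plus_False[of "q k"]
      by (cases "y k") (simp_all add: g_def expectation_pmf_of_set_bool)
    moreover have "measure_pmf.expectation (pmf_of_set UNIV) (g 0) \<le> 1"
      using expectation_likelihood_ratio_le_1[of q F y] by (simp add: g_def[abs_def])
    ultimately show "measure_pmf.expectation (pmf_of_set UNIV) (g k) \<le> 1"
      by (cases "k = 0") auto
  qed (auto simp: g_def likelihood_ratio_nonneg intro!: integral_nonneg_AE)
  finally show ?thesis .
qed

text \<open>A cross-over probability may be 0, so positivity holds only for noise in the support.
  Removing the sent bit from an output leaves the noise bit, which has positive probability.\<close>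

lemma
  assumes fin: "finite D" "finite F" and disj: "D \<inter> F = {}" and N: "N \<in> set_pmf (bits_pmf (D \<union> F) q)"
  shows likelihood_ratio_letter_output_pos: "0 < likelihood_ratio q F (a 0) (letter_output D F a N)"
    and pmf_letter_output_pos:
      "i \<in> D \<Longrightarrow> 0 < pmf (bernoulli_pmf (q i)) (letter_output D F a N i \<oplus> a i)"
proof -
  have pos: "0 < pmf (bernoulli_pmf (q i)) (N i)" if "i \<in> D \<union> F" for i
    using N that fin by (auto simp: set_Pi_pmf PiE_dflt_def pmf_positive)
  have "(letter_output D F a N i \<oplus> a 0) = N i" if "i \<in> F" for i
    using that disj by (auto simp: letter_output_def)
  then have "0 < likelihood q F (a 0) (letter_output D F a N)"
    using pos by (auto simp: likelihood_def intro!: prod_pos)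
  then show "0 < likelihood_ratio q F (a 0) (letter_output D F a N)"
    by (rule likelihood_ratio_pos)
  show "0 < pmf (bernoulli_pmf (q i)) (letter_output D F a N i \<oplus> a i)" if "i \<in> D"
  proof -
    have "(letter_output D F a N i \<oplus> a i) = N i"
      using that by (auto simp: letter_output_def)
    then show ?thesis
      using pos that by simp
  qed
qed

lemma letter_ratio_pos:
  assumes "finite D" "finite F" "D \<inter> F = {}" "N \<in> set_pmf (bits_pmf (D \<union> F) q)"
  shows "0 < letter_ratio q D F a (letter_output D F a N)"
  unfolding letter_ratio_def using assms
  by (intro mult_pos_pos prod_pos likelihood_ratio_letter_output_pos pmf_letter_output_pos) auto

text \<open>The logarithm of the factorised ratio is a sum. Its first term depends only on bit 0 and
  the noise on \<open>F\<close>, which together have law \<open>fwd_pmf\<close>; the term of relay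
  \<open>i\<close> depends only on its noise bit and has mean
  \<open>1 - bin_entropy (q i)\<close>.\<close>

lemma expectation_log_letter_ratio:
  assumes fin: "finite D" "finite F" and disj: "D \<inter> F = {}" and zero: "0 \<notin> D"
    and q: "\<And>i. i \<in> D \<Longrightarrow> 0 \<le> q i \<and> q i \<le> 1"
  shows "measure_pmf.expectation (pair_pmf (letter_pmf D) (bits_pmf (D \<union> F) q))
      (\<lambda>(a, N). log 2 (letter_ratio q D F a (letter_output D F a N))) =
    fwd_information q F + (\<Sum>i\<in>D. 1 - bin_entropy (q i))"
proof -
  let ?P = "letter_pmf D" and ?N = "bits_pmf (D \<union> F) q"
  let ?J = "pair_pmf ?P ?N"
  let ?l = "\<lambda>(a, N). log 2 (likelihood_ratio q F (a 0) (letter_output D F a N))"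
  let ?k = "\<lambda>i (a, N). log 2 (2 * pmf (bernoulli_pmf (q i)) (N i))"
  have finJ: "finite (set_pmf ?J)"
    using fin by (auto intro!: finite_set_Pi_pmf)
  have int: "integrable (measure_pmf ?J) (g :: _ \<Rightarrow> real)" for g
    using finJ by (rule integrable_measure_pmf_finite)
  have "measure_pmf.expectation ?J (\<lambda>(a, N). log 2 (letter_ratio q D F a (letter_output D F a N))) =
      measure_pmf.expectation ?J (\<lambda>x. ?l x + (\<Sum>i\<in>D. ?k i x))"
  proof (intro integral_cong_AE, simp, simp, unfold AE_measure_pmf_iff, intro ballI)
    fix x assume "x \<in> set_pmf ?J"
    moreover obtain a N where x: "x = (a, N)"
      by fastforce
    ultimately have N: "N \<in> set_pmf ?N" by simp
    have eq: "(letter_output D F a N i \<oplus> a i) = N i" if "i \<in> D" for i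
      using that by (auto simp: letter_output_def)
    have pos: "0 < 2 * pmf (bernoulli_pmf (q i)) (N i)" if "i \<in> D" for i
      using pmf_letter_output_pos[OF fin disj N that, of a] eq[OF that] by simp
    have prod: "(\<Prod>i\<in>D. 2 * pmf (bernoulli_pmf (q i)) (letter_output D F a N i \<oplus> a i)) =
        (\<Prod>i\<in>D. 2 * pmf (bernoulli_pmf (q i)) (N i))"
      using eq by (intro prod.cong) auto
    have "log 2 (letter_ratio q D F a (letter_output D F a N)) =
        log 2 (likelihood_ratio q F (a 0) (letter_output D F a N)) +
        log 2 (\<Prod>i\<in>D. 2 * pmf (bernoulli_pmf (q i)) (N i))"
      unfolding letter_ratio_def prod
      using likelihood_ratio_letter_output_pos[OF fin disj N, of a] prod_pos[of D, OF pos]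
      by (intro log_mult_pos) auto
    also have "log 2 (\<Prod>i\<in>D. 2 * pmf (bernoulli_pmf (q i)) (N i)) =
        (\<Sum>i\<in>D. log 2 (2 * pmf (bernoulli_pmf (q i)) (N i)))"
      using fin pos by (intro log_prod_pos) auto
    finally show "(case x of (a, N) \<Rightarrow> log 2 (letter_ratio q D F a (letter_output D F a N))) =
        ?l x + (\<Sum>i\<in>D. ?k i x)"
      by (simp add: x)
  qed
  also have "\<dots> = measure_pmf.expectation ?J ?l + (\<Sum>i\<in>D. measure_pmf.expectation ?J (?k i))"
    using int by (simp add: Bochner_Integration.integral_add Bochner_Integration.integral_sum)
  also have "measure_pmf.expectation ?J ?l = fwd_information q F"
  proof -
    let ?res = "\<lambda>N i. if i \<in> F then N i else False"
    have "fwd_pmf q F = map_pmf (\<lambda>(a, N). (a 0, ?res N)) ?J"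
      unfolding fwd_pmf_def map_pair
      using fin Pi_pmf_component[of "insert 0 D" 0 False "\<lambda>_. pmf_of_set UNIV"]
        Pi_pmf_subset[of "D \<union> F" F False "\<lambda>i. bernoulli_pmf (q i)"]
      by simp
    then have "fwd_information q F = measure_pmf.expectation ?J
        (\<lambda>x. log 2 (likelihood_ratio q F (fst x 0) (fwd_output F (fst x 0, ?res (snd x)))))"
      using fin by (simp add: fwd_information_eq case_prod_beta')
    also have "\<dots> = measure_pmf.expectation ?J ?l"
    proof -
      have "likelihood_ratio q F (fst x 0) (fwd_output F (fst x 0, ?res (snd x))) =
          likelihood_ratio q F (fst x 0) (letter_output D F (fst x) (snd x))" for x
        using disj by (intro likelihood_ratio_cong) (auto simp: fwd_output_def letter_output_def)
      then show ?thesis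
        by (simp add: case_prod_beta')
    qed
    finally show ?thesis ..
  qed
  also have "(\<Sum>i\<in>D. measure_pmf.expectation ?J (?k i)) = (\<Sum>i\<in>D. 1 - bin_entropy (q i))"
  proof (intro sum.cong refl)
    fix i assume i: "i \<in> D"
    have "map_pmf (\<lambda>(a, N). N i) ?J = map_pmf (\<lambda>N. N i) (map_pmf snd ?J)"
      by (simp add: map_pmf_comp case_prod_beta')
    also have "\<dots> = bernoulli_pmf (q i)"
      using i fin by (simp add: map_snd_pair_pmf Pi_pmf_component)
    finally have "measure_pmf.expectation (bernoulli_pmf (q i)) (\<lambda>b. log 2 (2 * pmf (bernoulli_pmf (q i)) b)) =
        measure_pmf.expectation (map_pmf (\<lambda>(a, N). N i) ?J) (\<lambda>b. log 2 (2 * pmf (bernoulli_pmf (q i)) b))"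
      by simp
    then show "measure_pmf.expectation ?J (?k i) = 1 - bin_entropy (q i)"
      unfolding expectation_log_bernoulli[OF q[OF i, THEN conjunct1] q[OF i, THEN conjunct2]]
      by (simp add: case_prod_beta')
  qed
  finally show ?thesis .
qed

subsection \<open>Block Markov coding in the relay network\<close>

lemma map_pmf_noise_block:
  assumes "i \<in> {1..K}" "Suc b * m \<le> n"
  shows "map_pmf (\<lambda>Z s. if s \<in> {..<m} then Z (i, b * m + s + 1) else False) (noise_pmf K n q) =
         Pi_pmf {..<m} False (\<lambda>_. bernoulli_pmf (q i))"
  unfolding noise_pmf_def using assms
  by (subst map_pmf_reindex_Pi_pmf) (auto simp: inj_on_def)

lemma map_pmf_xor_bernoulli:
  assumes "0 \<le> a" "a \<le> 1" "0 \<le> b" "b \<le> 1"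
  shows "map_pmf (\<lambda>(x, y). x \<oplus> y) (pair_pmf (bernoulli_pmf a) (bernoulli_pmf b)) =
         bernoulli_pmf (a * (1 - b) + (1 - a) * b)"
proof (rule pmf_eqI)
  fix z
  have le: "0 \<le> a * (1 - b) + (1 - a) * b" "a * (1 - b) + (1 - a) * b \<le> 1"
  proof -
    have "a * (1 - b) \<le> a" "(1 - a) * b \<le> 1 - a"
      using assms by (simp_all add: mult_left_le)
    then show "a * (1 - b) + (1 - a) * b \<le> 1" by linarith
  qed (use assms in simp)
  have "map_pmf (\<lambda>(x, y). x \<oplus> y) (pair_pmf (bernoulli_pmf a) (bernoulli_pmf b)) =
      bind_pmf (bernoulli_pmf a) (\<lambda>x. map_pmf (\<lambda>y. x \<oplus> y) (bernoulli_pmf b))"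
    by (simp add: pair_pmf_def map_bind_pmf map_pmf_def[symmetric] map_pmf_comp)
  moreover have "map_pmf (\<lambda>y. x \<oplus> y) (bernoulli_pmf b) =
      (if x then bernoulli_pmf (1 - b) else bernoulli_pmf b)" for x
  proof (cases x)
    case True
    have "pmf (map_pmf Not (bernoulli_pmf b)) y = pmf (bernoulli_pmf (1 - b)) y" for y
      using pmf_map_inj'[of Not "bernoulli_pmf b" "\<not> y"] assms by (cases y) (auto simp: inj_def)
    then show ?thesis
      using True by (auto intro: pmf_eqI)
  qed simp
  ultimately show "pmf (map_pmf (\<lambda>(x, y). x \<oplus> y) (pair_pmf (bernoulli_pmf a) (bernoulli_pmf b))) z =
      pmf (bernoulli_pmf (a * (1 - b) + (1 - a) * b)) z"
    using assms le by (cases z) (simp_all add: pmf_bind algebra_simps)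
qed

lemma Pi_pmf_map_dependent:
  assumes "finite A"
  shows "Pi_pmf A d (\<lambda>x. map_pmf (f x) (p x)) =
         map_pmf (\<lambda>h x. if x \<in> A then f x (h x) else d) (Pi_pmf A e p)"
  using assms Pi_pmf_bind[of A d p "\<lambda>x y. return_pmf (f x y)" e]
  by (simp add: map_pmf_def)

text \<open>
  The effective noise of the letters from which the destination decodes block \<open>b\<close>. Relays in \<open>D\<close>
  send block \<open>b\<close> one block late, the other relays repeat each symbol one time step late.
\<close>

definition letter_noise ::
    "nat set \<Rightarrow> nat \<Rightarrow> nat \<Rightarrow> nat \<Rightarrow> (nat \<times> nat \<Rightarrow> bool) \<Rightarrow> (nat \<times> nat \<Rightarrow> bool) \<Rightarrow> nat \<Rightarrow> nat \<Rightarrow> bool"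
  where "letter_noise D K m b Z E s i \<longleftrightarrow> (s, i) \<in> {..<m} \<times> {1..K} \<and>
    (if i \<in> D then E (i, Suc b * m + s + 1) else Z (i, b * m + s + 1) \<oplus> E (i, b * m + s + 2))"

text \<open>No two entries share a bit of \<open>Z\<close> or \<open>E\<close>, so they are
  independent. A relay in \<open>D\<close> contributes only the noise of its last link, the others
  that of two links in cascade. The bound on \<open>n\<close> is needed since the letters of block
  \<open>b\<close> extend into block \<open>b + 1\<close>.\<close>

lemma map_pmf_letter_noise:
  assumes ps: "\<And>i. i \<in> {1..K} \<Longrightarrow> 0 \<le> ps i \<and> ps i \<le> 1"
    and pd: "\<And>i. i \<in> {1..K} \<Longrightarrow> 0 \<le> pd i \<and> pd i \<le> 1"
    and n: "(b + 2) * m \<le> n"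
  shows "map_pmf (\<lambda>(Z, E). letter_noise D K m b Z E) (pair_pmf (noise_pmf K n ps) (noise_pmf K n pd)) =
    Pi_pmf {..<m} (\<lambda>_. False)
      (\<lambda>_. bits_pmf {1..K} (\<lambda>i. if i \<in> D then pd i else crossover ps pd i))"
proof -
  let ?q = "\<lambda>i. if i \<in> D then pd i else crossover ps pd i"
  let ?S = "{..<m} \<times> {1..K}"
  let ?hZ = "\<lambda>(s, i). (i, b * m + s + 1)"
  \<comment> \<open>The shift depends on the relay only, so the index map stays injective although
    the two kinds of relays are read at different times.\<close>
  let ?hE = "\<lambda>(s, i). (i, if i \<in> D then Suc b * m + s + 1 else b * m + s + 2)"
  let ?rZ = "\<lambda>Z x. if x \<in> ?S then Z (?hZ x) else False"
  let ?rE = "\<lambda>E x. if x \<in> ?S then E (?hE x) else False"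
  let ?F = "\<lambda>(s, i) (z, e). if i \<in> D then e else z \<oplus> e"
  have Z: "map_pmf ?rZ (noise_pmf K n ps) = Pi_pmf ?S False (\<lambda>(s, i). bernoulli_pmf (ps i))"
    unfolding noise_pmf_def using n
    by (subst map_pmf_reindex_Pi_pmf) (auto simp: inj_on_def case_prod_beta')
  have E: "map_pmf ?rE (noise_pmf K n pd) = Pi_pmf ?S False (\<lambda>(s, i). bernoulli_pmf (pd i))"
    unfolding noise_pmf_def using n
    by (subst map_pmf_reindex_Pi_pmf) (auto simp: inj_on_def case_prod_beta' split: if_splits)
  have bit: "map_pmf (?F x) (pair_pmf (bernoulli_pmf (ps (snd x))) (bernoulli_pmf (pd (snd x)))) =
      bernoulli_pmf (?q (snd x))" if "x \<in> ?S" for x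
  proof (cases "snd x \<in> D")
    case True
    then show ?thesis
      using map_snd_pair_pmf[of "bernoulli_pmf (ps (snd x))" "bernoulli_pmf (pd (snd x))"]
      by (simp add: case_prod_beta')
  next
    case False
    then show ?thesis
      using that ps[of "snd x"] pd[of "snd x"]
        map_pmf_xor_bernoulli[of "ps (snd x)" "pd (snd x)"]
      by (auto simp: case_prod_beta' crossover_def)
  qed
  have "(\<lambda>(Z, E). letter_noise D K m b Z E) =
     curry \<circ> (\<lambda>h x. if x \<in> ?S then ?F x (h x) else False) \<circ> (\<lambda>(f, g) x. (f x, g x)) \<circ> (\<lambda>(Z, E). (?rZ Z, ?rE E))"
    by (auto simp: fun_eq_iff letter_noise_def)
  then have "map_pmf (\<lambda>(Z, E). letter_noise D K m b Z E) (pair_pmf (noise_pmf K n ps) (noise_pmf K n pd)) =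
     map_pmf curry (map_pmf (\<lambda>h x. if x \<in> ?S then ?F x (h x) else False)
       (map_pmf (\<lambda>(f, g) x. (f x, g x)) (pair_pmf (map_pmf ?rZ (noise_pmf K n ps)) (map_pmf ?rE (noise_pmf K n pd)))))"
    by (simp only: pmf.map_comp map_pair[symmetric] o_assoc)
  also have "\<dots> = map_pmf curry (Pi_pmf ?S False (\<lambda>(s, i). bernoulli_pmf (?q i)))"
    unfolding Z E
    by (simp only: map_pmf_pair_Pi_pmf Pi_pmf_map_dependent[symmetric] finite_SigmaI finite_lessThan finite_atLeastAtMost)
      (intro arg_cong[where f = "map_pmf curry"] Pi_pmf_cong refl, use bit in \<open>simp add: case_prod_beta'\<close>)
  also have "\<dots> = Pi_pmf {..<m} (\<lambda>_. False) (\<lambda>_. bits_pmf {1..K} ?q)"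
    by (rule map_pmf_curry_Pi_pmf) auto
  finally show ?thesis .
qed

section \<open>Message digits and correctness of the block code when no block decoder errs\<close>

definition digit :: "nat \<Rightarrow> nat \<Rightarrow> nat \<Rightarrow> nat"
  where "digit M b w = w div M ^ b mod M"

lemma sum_digits: "(\<Sum>b<B. digit M b w * M ^ b) = w mod M ^ B"
proof (induction B)
  case (Suc B)
  then show ?case
    using mod_mult2_eq[of w "M ^ B" M] by (simp add: digit_def mult.commute)
qed simp

text \<open>
  The block Markov code built from a codebook \<open>C\<close>, where \<open>C v s 0\<close> and \<open>C v s i\<close> are the symbols
  number \<open>s < m\<close> of the codewords of \<open>v\<close> at the source and at relay \<open>i \<in> D\<close>. The message is split
  into \<open>B\<close> digits in base \<open>M\<close>, one for each block of length \<open>m\<close>; \<open>dr i\<close> and \<open>dd\<close> are the block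
  decoders of relay \<open>i\<close> and of the destination.
\<close>

definition block_code ::
    "nat set \<Rightarrow> nat \<Rightarrow> nat \<Rightarrow> nat \<Rightarrow> nat \<Rightarrow> (nat \<Rightarrow> (nat \<Rightarrow> bool) \<Rightarrow> nat)
      \<Rightarrow> ((nat \<Rightarrow> nat \<Rightarrow> bool) \<Rightarrow> nat) \<Rightarrow> (nat \<Rightarrow> nat \<Rightarrow> nat \<Rightarrow> bool) \<Rightarrow> code"
  where "block_code D K m B M dr dd C =
    \<lparr>encode = (\<lambda>w t. C (digit M ((t - 1) div m) w) ((t - 1) mod m) 0),
     relay = (\<lambda>i t v. if i \<in> D
       then m \<le> t - 1 \<and> C (dr i (\<lambda>s. v ! (((t - 1) div m - 1) * m + s))) ((t - 1) mod m) i
       else v \<noteq> [] \<and> last v),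
     decode = (\<lambda>y. \<Sum>b<B. dd (\<lambda>s i. i \<in> {1..K} \<and>
       y (i, if i \<in> D then Suc b * m + s + 1 else b * m + s + 2)) * M ^ b)\<rparr>"

text \<open>The deterministic half of the analysis: if all relays in \<open>D\<close> and the
  destination decode all digits, the message is recovered. \<open>B\<close> digits take
  \<open>B + 1\<close> blocks because relays in \<open>D\<close> lag one block behind. By the
  congruence hypotheses the decoders look only at the \<open>m\<close> symbols of a block.\<close>

lemma decode_block_code:
  fixes D F :: "nat set" and w M :: nat
  defines "v \<equiv> \<lambda>b. digit M b w"
  assumes DF: "D \<union> F = {1..K}"
    and w: "w < M ^ B" and n: "(B + 1) * m \<le> n"
    and cong_r: "\<And>i y y'. (\<And>s. s < m \<Longrightarrow> y s = y' s) \<Longrightarrow> dr i y = dr i y'"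
    and cong_d: "\<And>y y'. (\<And>s. s < m \<Longrightarrow> y s = y' s) \<Longrightarrow> dd y = dd y'"
    and dr: "\<And>i b. i \<in> D \<Longrightarrow> b < B \<Longrightarrow>
      dr i (\<lambda>s. C (v b) s 0 \<oplus> (if s \<in> {..<m} then Z (i, b * m + s + 1) else False)) = v b"
    and dd: "\<And>b. b < B \<Longrightarrow>
      dd (\<lambda>s. letter_output D F (C (v b) s) (letter_noise D K m b Z E s)) = v b"
  shows "decode (block_code D K m B M dr dd C)
    (restrict (dest_received (block_code D K m B M dr dd C) w Z E) ({1..K} \<times> {1..n})) = w"
proof -
  let ?c = "block_code D K m B M dr dd C"
  let ?y = "restrict (dest_received ?c w Z E) ({1..K} \<times> {1..n})"
  have rec: "relay_received ?c w Z i (b * m + s + 1) = (C (v b) s 0 \<oplus> Z (i, b * m + s + 1))"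
    if "s < m" for i b s
    using that by (simp add: relay_received_def block_code_def v_def)
  \<comment> \<open>Throughout block \<open>b + 1\<close> the relay has already received all of
    block \<open>b\<close>, so decoding it respects causality.\<close>
  have sent_D: "relay_sent ?c w Z i (Suc b * m + s + 1) = C (v b) s i"
    if "i \<in> D" "b < B" "s < m" for i b s
  proof -
    let ?t = "Suc b * m + s + 1"
    let ?v = "map (relay_received ?c w Z i) [1..<?t]"
    have "?v ! (b * m + s') = (C (v b) s' 0 \<oplus> (if s' \<in> {..<m} then Z (i, b * m + s' + 1) else False))"
      if "s' < m" for s'
      using that rec[OF that, of i b] by (simp add: nth_upt del: upt_Suc)
    then have "dr i (\<lambda>s'. ?v ! (b * m + s')) =
        dr i (\<lambda>s. C (v b) s 0 \<oplus> (if s \<in> {..<m} then Z (i, b * m + s + 1) else False))"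
      by (rule cong_r)
    also have "\<dots> = v b"
      by (rule dr[OF \<open>i \<in> D\<close> \<open>b < B\<close>])
    finally have "dr i (\<lambda>s'. ?v ! (b * m + s')) = v b" .
    moreover have "relay_sent ?c w Z i ?t =
        (m \<le> ?t - 1 \<and> C (dr i (\<lambda>s'. ?v ! (((?t - 1) div m - 1) * m + s'))) ((?t - 1) mod m) i)"
      using \<open>i \<in> D\<close> unfolding relay_sent_def by (simp add: block_code_def del: upt_Suc)
    moreover have "?t - 1 = Suc b * m + s" by simp
    moreover have "(Suc b * m + s) div m = Suc b" "(Suc b * m + s) mod m = s"
      using \<open>s < m\<close> by (simp_all add: div_mult_self3 del: mult_Suc)
    ultimately show ?thesis
      by (simp only: diff_Suc_1) simp
  qed
  \<comment> \<open>The last symbol heard before time \<open>b * m + s + 2\<close> is symbol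
    \<open>s\<close> of block \<open>b\<close>. For \<open>s = m - 1\<close> it is sent in the first
    slot of the next block, where the destination expects it.\<close>
  have sent_F: "relay_sent ?c w Z i (b * m + s + 2) = (C (v b) s 0 \<oplus> Z (i, b * m + s + 1))"
    if "i \<notin> D" "s < m" for i b s
    using that rec[OF that(2), of i b] unfolding relay_sent_def
    by (simp add: block_code_def)
  have "dd (\<lambda>s i. i \<in> {1..K} \<and> ?y (i, if i \<in> D then Suc b * m + s + 1 else b * m + s + 2)) = v b"
    if b: "b < B" for b
  proof -
    have "(i \<in> {1..K} \<and> ?y (i, if i \<in> D then Suc b * m + s + 1 else b * m + s + 2)) =
        letter_output D F (C (v b) s) (letter_noise D K m b Z E s) i" if s: "s < m" for s i
    proof (cases "i \<in> {1..K}")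
      case True
      have "(b + 2) * m \<le> (B + 1) * m"
        using b by (intro mult_le_mono1) simp
      then have "b * m + 2 * m \<le> n"
        using n by (simp add: algebra_simps)
      \<comment> \<open>Both reading times lie within the transmission, so \<open>restrict\<close>
        leaves these outputs unchanged.\<close>
      then have t: "Suc b * m + s + 1 \<in> {1..n}" "b * m + s + 2 \<in> {1..n}"
        using s by auto
      show ?thesis
      proof (cases "i \<in> D")
        case iD: True
        then show ?thesis
          using True DF t(1) sent_D[OF iD b s] s
          by (auto simp: dest_received_def letter_output_def letter_noise_def)
      next
        case False
        then show ?thesis
          using True DF t(2) sent_F[OF False s, of b] s
          by (auto simp: dest_received_def letter_output_def letter_noise_def)
      qed
    next
      case False
      then show ?thesis
        using DF by (auto simp: letter_output_def)
    qed
    then have "dd (\<lambda>s i. i \<in> {1..K} \<and> ?y (i, if i \<in> D then Suc b * m + s + 1 else b * m + s + 2)) =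
        dd (\<lambda>s. letter_output D F (C (v b) s) (letter_noise D K m b Z E s))"
      by (intro cong_d ext)
    also have "\<dots> = v b"
      by (rule dd[OF b])
    finally show ?thesis .
  qed
  then have "decode ?c ?y = (\<Sum>b<B. v b * M ^ b)"
    by (simp add: block_code_def del: mult_Suc)
  also have "\<dots> = w"
    using w by (simp add: v_def sum_digits)
  finally show ?thesis .
qed

text \<open>A relay sees only bit 0 of each letter. The codebook nevertheless carries the other bits
  too, so that this bound and that for the destination refer to the same random codebook.\<close>

lemma relay_random_coding:
  assumes "finite D" "0 \<le> q" "q \<le> 1" "R' < 1 - bin_entropy q"
  shows "\<exists>\<theta> \<beta>. \<beta> \<longlonglongrightarrow> 0 \<and> (\<forall>m M w. real M \<le> 2 powr (real m * R') + 1 \<longrightarrow> w < M \<longrightarrow>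
     measure_pmf.prob (pair_pmf (Pi_pmf {..<M} (\<lambda>_ _. False) (\<lambda>_. Pi_pmf {..<m} (\<lambda>_. False) (\<lambda>_. letter_pmf D)))
       (Pi_pmf {..<m} False (\<lambda>_. bernoulli_pmf q)))
       {(C, N). threshold_decoder (\<lambda>a y. 2 * pmf (bernoulli_pmf q) (y \<oplus> a 0)) \<theta> m M C
         (\<lambda>s. C w s 0 \<oplus> N s) \<noteq> w} \<le> \<beta> m)"
proof (rule random_coding)
  show "finite (set_pmf (letter_pmf D))"
    using assms by (intro finite_set_Pi_pmf) auto
  show "finite (set_pmf (bernoulli_pmf q))" by simp
  fix a N assume "N \<in> set_pmf (bernoulli_pmf q)"
  moreover have "((a 0 \<oplus> N) \<oplus> a 0) = N" by auto
  ultimately show "0 < 2 * pmf (bernoulli_pmf q) ((a 0 \<oplus> N) \<oplus> a 0)"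
    by (simp add: pmf_positive)
next
  fix y
  have "measure_pmf.expectation (letter_pmf D) (\<lambda>a. 2 * pmf (bernoulli_pmf q) (y \<oplus> a 0)) =
      measure_pmf.expectation (map_pmf (\<lambda>a. a 0) (letter_pmf D)) (\<lambda>b. 2 * pmf (bernoulli_pmf q) (y \<oplus> b))"
    by simp
  also have "\<dots> = 1"
    using assms pmf_bernoulli_True_plus_False[of q]
    by (cases y) (simp_all add: Pi_pmf_component expectation_pmf_of_set_bool del: integral_map_pmf)
  finally show "measure_pmf.expectation (letter_pmf D) (\<lambda>a. 2 * pmf (bernoulli_pmf q) (y \<oplus> a 0)) \<le> 1"
    by simp
next
  have "((a 0 \<oplus> N) \<oplus> a 0) = N" for a :: "nat \<Rightarrow> bool" and N by auto
  then have "measure_pmf.expectation (pair_pmf (letter_pmf D) (bernoulli_pmf q))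
      (\<lambda>(a, N). log 2 (2 * pmf (bernoulli_pmf q) ((a 0 \<oplus> N) \<oplus> a 0))) =
      measure_pmf.expectation (map_pmf snd (pair_pmf (letter_pmf D) (bernoulli_pmf q)))
        (\<lambda>N. log 2 (2 * pmf (bernoulli_pmf q) N))"
    by (simp add: case_prod_beta')
  also have "\<dots> = 1 - bin_entropy q"
    unfolding map_snd_pair_pmf using assms by (rule_tac expectation_log_bernoulli)
  finally show "R' < measure_pmf.expectation (pair_pmf (letter_pmf D) (bernoulli_pmf q))
      (\<lambda>(a, N). log 2 (2 * pmf (bernoulli_pmf q) ((a 0 \<oplus> N) \<oplus> a 0)))"
    using assms by simp
qed simp

lemma destination_random_coding:
  assumes fin: "finite D" "finite F" and disj: "D \<inter> F = {}" and zero: "0 \<notin> D"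
    and q: "\<And>i. i \<in> D \<Longrightarrow> 0 \<le> q i \<and> q i \<le> 1"
    and R': "R' < fwd_information q F + (\<Sum>i\<in>D. 1 - bin_entropy (q i))"
  shows "\<exists>\<theta> \<beta>. \<beta> \<longlonglongrightarrow> 0 \<and> (\<forall>m M w. real M \<le> 2 powr (real m * R') + 1 \<longrightarrow> w < M \<longrightarrow>
     measure_pmf.prob (pair_pmf (Pi_pmf {..<M} (\<lambda>_ _. False) (\<lambda>_. Pi_pmf {..<m} (\<lambda>_. False) (\<lambda>_. letter_pmf D)))
       (Pi_pmf {..<m} (\<lambda>_. False) (\<lambda>_. bits_pmf (D \<union> F) q)))
       {(C, N). threshold_decoder (letter_ratio q D F) \<theta> m M C
         (\<lambda>s. letter_output D F (C w s) (N s)) \<noteq> w} \<le> \<beta> m)"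
proof (rule random_coding)
  show "finite (set_pmf (letter_pmf D))" "finite (set_pmf (bits_pmf (D \<union> F) q))"
    using fin by (auto intro!: finite_set_Pi_pmf)
  show "R' < measure_pmf.expectation (pair_pmf (letter_pmf D) (bits_pmf (D \<union> F) q))
      (\<lambda>(a, N). log 2 (letter_ratio q D F a (letter_output D F a N)))"
    using R' q by (subst expectation_log_letter_ratio[OF fin disj zero]) auto
qed (use assms in \<open>auto intro!: letter_ratio_nonneg letter_ratio_pos expectation_letter_ratio_le_1\<close>)

section \<open>Error probability averaged over messages and codebooks\<close>

lemma prob_pair_map_pmf:
  "measure_pmf.prob (pair_pmf p q) {(x, y). Q x (h y)} =
   measure_pmf.prob (pair_pmf p (map_pmf h q)) {(x, y). Q x y}"
  by (simp add: pair_map_pmf2 vimage_def case_prod_beta')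

text \<open>A union bound over the \<open>B\<close> blocks and over the decoders of the relays in
  \<open>D\<close> and of the destination. All blocks share one codebook, so their errors may be
  dependent, but each single bound involves only the codebook and the noise relevant to one
  block.\<close>

lemma prob_block_code_error_le:
  fixes Cod :: "(nat \<Rightarrow> nat \<Rightarrow> nat \<Rightarrow> bool) pmf"
  assumes ps: "\<And>i. i \<in> {1..K} \<Longrightarrow> 0 \<le> ps i \<and> ps i \<le> 1"
    and pd: "\<And>i. i \<in> {1..K} \<Longrightarrow> 0 \<le> pd i \<and> pd i \<le> 1"
    and DF: "D \<union> F = {1..K}"
    and w: "w < M ^ B" and n: "(B + 1) * m \<le> n"
    and cong_r: "\<And>C i y y'. (\<And>s. s < m \<Longrightarrow> y s = y' s) \<Longrightarrow> dr C i y = dr C i y'"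
    and cong_d: "\<And>C y y'. (\<And>s. s < m \<Longrightarrow> y s = y' s) \<Longrightarrow> dd C y = dd C y'"
    and dr: "\<And>i v. i \<in> D \<Longrightarrow> v < M \<Longrightarrow>
      measure_pmf.prob (pair_pmf Cod (Pi_pmf {..<m} False (\<lambda>_. bernoulli_pmf (ps i))))
        {(C, N). dr C i (\<lambda>s. C v s 0 \<oplus> N s) \<noteq> v} \<le> \<beta>r i"
    and dd: "\<And>v. v < M \<Longrightarrow>
      measure_pmf.prob (pair_pmf Cod (Pi_pmf {..<m} (\<lambda>_. False)
          (\<lambda>_. bits_pmf {1..K} (\<lambda>i. if i \<in> D then pd i else crossover ps pd i))))
        {(C, N). dd C (\<lambda>s. letter_output D F (C v s) (N s)) \<noteq> v} \<le> \<beta>d"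
  shows "measure_pmf.prob (pair_pmf Cod (pair_pmf (noise_pmf K n ps) (noise_pmf K n pd)))
      {(C, Z, E). decode (block_code D K m B M (dr C) (dd C) C)
        (restrict (dest_received (block_code D K m B M (dr C) (dd C) C) w Z E) ({1..K} \<times> {1..n})) \<noteq> w}
    \<le> real B * ((\<Sum>i\<in>D. \<beta>r i) + \<beta>d)"
proof -
  let ?P = "pair_pmf Cod (pair_pmf (noise_pmf K n ps) (noise_pmf K n pd))"
  let ?v = "\<lambda>b. digit M b w"
  let ?R = "\<lambda>b i. {(C, Z, E). dr C i (\<lambda>s. C (?v b) s 0 \<oplus>
    (if s \<in> {..<m} then Z (i, b * m + s + 1) else False)) \<noteq> ?v b}"
  let ?G = "\<lambda>b. {(C, Z, E). dd C (\<lambda>s. letter_output D F (C (?v b) s) (letter_noise D K m b Z E s)) \<noteq> ?v b}"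
  let ?Err = "{(C, Z, E). decode (block_code D K m B M (dr C) (dd C) C)
        (restrict (dest_received (block_code D K m B M (dr C) (dd C) C) w Z E) ({1..K} \<times> {1..n})) \<noteq> w}"
  have finD: "finite D"
    using DF by (metis finite_Un finite_atLeastAtMost)
  have sub: "?Err \<subseteq> (\<Union>b\<in>{..<B}. (\<Union>i\<in>D. ?R b i) \<union> ?G b)"
  proof (intro subsetI, rule ccontr)
    fix x
    assume x: "x \<in> ?Err" "x \<notin> (\<Union>b\<in>{..<B}. (\<Union>i\<in>D. ?R b i) \<union> ?G b)"
    obtain C Z E where xeq: "x = (C, Z, E)"
      by (cases x) auto
    have err: "decode (block_code D K m B M (dr C) (dd C) C)
        (restrict (dest_received (block_code D K m B M (dr C) (dd C) C) w Z E) ({1..K} \<times> {1..n})) \<noteq> w"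
      using x(1) by (simp add: xeq)
    have no: "(C, Z, E) \<notin> (\<Union>b\<in>{..<B}. (\<Union>i\<in>D. ?R b i) \<union> ?G b)"
      using x(2) by (simp only: xeq not_False_eq_True)
    have "decode (block_code D K m B M (dr C) (dd C) C)
        (restrict (dest_received (block_code D K m B M (dr C) (dd C) C) w Z E) ({1..K} \<times> {1..n})) = w"
      using no by (intro decode_block_code[OF DF w n cong_r cong_d]) auto
    with err show False by contradiction
  qed
  have v: "?v b < M" if "b < B" for b
  proof -
    have "M > 0"
      using w that by (cases "M = 0") (auto simp: power_0_left)
    then show ?thesis
      by (simp add: digit_def)
  qed
  have le: "(b + 2) * m \<le> n" if "b < B" for b
  proof -
    have "(b + 2) * m \<le> (B + 1) * m"
      using that by (intro mult_le_mono1) simp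
    with n show ?thesis by simp
  qed
  have R: "measure_pmf.prob ?P (?R b i) \<le> \<beta>r i" if "b < B" "i \<in> D" for b i
  proof -
    let ?h = "\<lambda>Z s. if s \<in> {..<m} then Z (i, b * m + s + 1) else False"
    have "Suc b * m \<le> n"
      using le[OF \<open>b < B\<close>] by simp
    moreover have "i \<in> {1..K}"
      using that DF by blast
    moreover have "map_pmf (\<lambda>x. ?h (fst x)) (pair_pmf (noise_pmf K n ps) (noise_pmf K n pd)) =
        map_pmf ?h (map_pmf fst (pair_pmf (noise_pmf K n ps) (noise_pmf K n pd)))"
      by (simp add: map_pmf_comp)
    ultimately have h: "map_pmf (\<lambda>x. ?h (fst x)) (pair_pmf (noise_pmf K n ps) (noise_pmf K n pd)) =
        Pi_pmf {..<m} False (\<lambda>_. bernoulli_pmf (ps i))"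
      by (simp only: map_fst_pair_pmf map_pmf_noise_block)
    have "measure_pmf.prob ?P (?R b i) = measure_pmf.prob ?P
        {(C, x). dr C i (\<lambda>s. C (?v b) s 0 \<oplus> ?h (fst x) s) \<noteq> ?v b}"
      by (simp add: case_prod_beta')
    also have "\<dots> \<le> \<beta>r i"
      using dr[OF \<open>i \<in> D\<close> v[OF \<open>b < B\<close>]]
      by (subst prob_pair_map_pmf[where h = "\<lambda>x. ?h (fst x)" and Q = "\<lambda>C N. dr C i (\<lambda>s. C (?v b) s 0 \<oplus> N s) \<noteq> ?v b"])
         (simp only: h)
    finally show ?thesis .
  qed
  have G: "measure_pmf.prob ?P (?G b) \<le> \<beta>d" if "b < B" for b
  proof -
    let ?h = "\<lambda>(Z, E). letter_noise D K m b Z E"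
    have h: "map_pmf ?h (pair_pmf (noise_pmf K n ps) (noise_pmf K n pd)) =
        Pi_pmf {..<m} (\<lambda>_. False) (\<lambda>_. bits_pmf {1..K} (\<lambda>i. if i \<in> D then pd i else crossover ps pd i))"
      using ps pd le[OF that] by (rule map_pmf_letter_noise)
    have "measure_pmf.prob ?P (?G b) = measure_pmf.prob ?P
        {(C, x). dd C (\<lambda>s. letter_output D F (C (?v b) s) (?h x s)) \<noteq> ?v b}"
      by (simp add: case_prod_beta')
    also have "\<dots> \<le> \<beta>d"
      using dd[OF v[OF that]]
      by (subst prob_pair_map_pmf[where h = ?h and
            Q = "\<lambda>C N. dd C (\<lambda>s. letter_output D F (C (?v b) s) (N s)) \<noteq> ?v b"]) (simp only: h)
    finally show ?thesis .
  qed
  have "measure_pmf.prob ?P ?Err \<le> measure_pmf.prob ?P (\<Union>b\<in>{..<B}. (\<Union>i\<in>D. ?R b i) \<union> ?G b)"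
    using sub by (intro measure_pmf.finite_measure_mono) auto
  also have "\<dots> \<le> (\<Sum>b<B. measure_pmf.prob ?P ((\<Union>i\<in>D. ?R b i) \<union> ?G b))"
    by (intro measure_UNION_le) auto
  also have "\<dots> \<le> (\<Sum>b<B. (\<Sum>i\<in>D. \<beta>r i) + \<beta>d)"
  proof (intro sum_mono)
    fix b assume "b \<in> {..<B}"
    then have b: "b < B" by simp
    have "measure_pmf.prob ?P ((\<Union>i\<in>D. ?R b i) \<union> ?G b) \<le>
        measure_pmf.prob ?P (\<Union>i\<in>D. ?R b i) + measure_pmf.prob ?P (?G b)"
      by (intro measure_Un_le) auto
    also have "measure_pmf.prob ?P (\<Union>i\<in>D. ?R b i) \<le> (\<Sum>i\<in>D. measure_pmf.prob ?P (?R b i))"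
      using finD by (intro measure_UNION_le) auto
    also have "\<dots> \<le> (\<Sum>i\<in>D. \<beta>r i)"
      using R[OF b] by (intro sum_mono) auto
    finally show "measure_pmf.prob ?P ((\<Union>i\<in>D. ?R b i) \<union> ?G b) \<le> (\<Sum>i\<in>D. \<beta>r i) + \<beta>d"
      using G[OF b] by linarith
  qed
  also have "\<dots> = real B * ((\<Sum>i\<in>D. \<beta>r i) + \<beta>d)"
    by simp
  finally show ?thesis .
qed

lemma pair_left_commute_pmf:
  "pair_pmf p (pair_pmf q r) = map_pmf (\<lambda>(y, x, z). (x, y, z)) (pair_pmf q (pair_pmf p r))"
  unfolding pair_pmf_def
  by (subst bind_assoc_pmf, subst bind_commute_pmf)
     (simp add: map_pmf_def bind_assoc_pmf bind_return_pmf)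

text \<open>A bound that holds for each message, averaged over codebooks, also holds after averaging
  over messages. Exchanging the two averages then yields one codebook that serves the uniform
  message.\<close>

lemma ex_code_error_prob_le:
  assumes "0 < num_messages R n"
    and "\<And>w. w < num_messages R n \<Longrightarrow>
      measure_pmf.prob (pair_pmf Cod (pair_pmf (noise_pmf K n ps) (noise_pmf K n pd)))
        {(C, Z, E). decode (c C) (restrict (dest_received (c C) w Z E) ({1..K} \<times> {1..n})) \<noteq> w} \<le> \<delta>"
  shows "\<exists>C. error_prob K ps pd R n (c C) \<le> \<delta>"
proof -
  let ?N = "pair_pmf (noise_pmf K n ps) (noise_pmf K n pd)"
  let ?W = "pmf_of_set {..<num_messages R n}"
  let ?A = "{(C, w, Z, E). decode (c C) (restrict (dest_received (c C) w Z E) ({1..K} \<times> {1..n})) \<noteq> w}"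
  have set: "set_pmf ?W = {..<num_messages R n}"
    using assms(1) by (intro set_pmf_of_set) auto
  have "measure_pmf.prob (pair_pmf Cod (pair_pmf ?W ?N)) ?A =
      measure_pmf.prob (pair_pmf ?W (pair_pmf Cod ?N)) {(w, C, x). (C, w, x) \<in> ?A}"
    by (subst pair_left_commute_pmf) (simp add: vimage_def case_prod_beta')
  also have "\<dots> \<le> \<delta>"
    unfolding prob_pair_pmf[of ?W] using assms(2) set
    by (intro expectation_prob_le) (auto simp: case_prod_beta')
  finally obtain C where "measure_pmf.prob (pair_pmf ?W ?N) {y. (C, y) \<in> ?A} \<le> \<delta>"
    using ex_prob_section_le by blast
  then show ?thesis
    unfolding error_prob_def network_pmf_def by (intro exI[of _ C]) simp
qed

theorem theorem8:
  fixes K :: nat and ps pd :: "nat \<Rightarrow> real" and D :: "nat set" and R :: real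
  assumes "K \<ge> 1"
    and "\<And>i. i \<in> {1..K} \<Longrightarrow> 0 \<le> ps i \<and> ps i \<le> 1 / 2"
    and "\<And>i. i \<in> {1..K} \<Longrightarrow> 0 \<le> pd i \<and> pd i \<le> 1 / 2"
    and "D \<subseteq> {1..K}"
    and "0 \<le> R" and "R < hybrid_rate K ps pd D"
  shows "achievable K ps pd R"
proof -
  define F where "F = {1..K} - D"
  have fin: "finite D" "finite F" and disj: "D \<inter> F = {}" and zero: "0 \<notin> D" and DF: "D \<union> F = {1..K}"
    using assms(4) finite_subset[OF assms(4)] by (auto simp: F_def)
  have ps: "0 \<le> ps i \<and> ps i \<le> 1" and pd: "0 \<le> pd i \<and> pd i \<le> 1" if "i \<in> {1..K}" for i
    using assms(2,3)[OF that] by auto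
  define q where "q i = (if i \<in> D then pd i else crossover ps pd i)" for i
  \<comment> \<open>The gap between \<open>R\<close> and \<open>R'\<close> will pay for the extra
    block and for rounding.\<close>
  obtain R' where R': "R < R'" "R' < hybrid_rate K ps pd D"
    using assms(6) dense by blast
  \<comment> \<open>Entropy is increasing on [0, 1/2], so a rate that the worst relay in
    \<open>D\<close> can decode suits every relay in \<open>D\<close>.\<close>
  have R'_relay: "R' < 1 - bin_entropy (ps i)" if "i \<in> D" for i
  proof -
    have max: "ps i \<le> Max (ps ` D)" "Max (ps ` D) \<in> ps ` D"
      using that fin by (auto intro!: Max_in)
    then have "Max (ps ` D) \<le> 1 / 2"
      using assms(2,4) by auto
    then have "bin_entropy (ps i) \<le> bin_entropy (Max (ps ` D))"
      using max that assms(4) ps by (intro bin_entropy_mono) auto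
    moreover have "R' < 1 - bin_entropy (Max (ps ` D))"
      using R'(2) that by (auto simp: hybrid_rate_def split: if_splits)
    ultimately show ?thesis by simp
  qed
  have "fwd_information q F = fwd_information (crossover ps pd) F"
  proof -
    have "fwd_pmf q F = fwd_pmf (crossover ps pd) F"
      unfolding fwd_pmf_def using disj
      by (intro arg_cong[where f = "pair_pmf _"] Pi_pmf_cong) (auto simp: q_def)
    then show ?thesis
      by (simp add: fwd_information_def)
  qed
  then have R'_dest: "R' < fwd_information q F + (\<Sum>i\<in>D. 1 - bin_entropy (q i))"
    using R'(2) by (simp add: hybrid_rate_def F_def q_def)

  let ?Cod = "\<lambda>m M. Pi_pmf {..<M} (\<lambda>_ _. False) (\<lambda>_. Pi_pmf {..<m} (\<lambda>_. False) (\<lambda>_. letter_pmf D))"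
  define rr where "rr i a y = 2 * pmf (bernoulli_pmf (ps i)) (y \<oplus> a 0)" for i y and a :: "nat \<Rightarrow> bool"
  have "\<forall>i\<in>D. \<exists>\<theta> \<beta>. \<beta> \<longlonglongrightarrow> 0 \<and> (\<forall>m M w. real M \<le> 2 powr (real m * R') + 1 \<longrightarrow> w < M \<longrightarrow>
     measure_pmf.prob (pair_pmf (?Cod m M) (Pi_pmf {..<m} False (\<lambda>_. bernoulli_pmf (ps i))))
       {(C, N). threshold_decoder (rr i) \<theta> m M C (\<lambda>s. C w s 0 \<oplus> N s) \<noteq> w} \<le> \<beta> m)"
    unfolding rr_def using fin ps assms(4) R'_relay by (intro ballI relay_random_coding) auto
  then obtain \<theta>r \<beta>r where relay: "\<And>i. i \<in> D \<Longrightarrow> \<beta>r i \<longlonglongrightarrow> 0"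
    "\<And>i m M w. i \<in> D \<Longrightarrow> real M \<le> 2 powr (real m * R') + 1 \<Longrightarrow> w < M \<Longrightarrow>
     measure_pmf.prob (pair_pmf (?Cod m M) (Pi_pmf {..<m} False (\<lambda>_. bernoulli_pmf (ps i))))
       {(C, N). threshold_decoder (rr i) (\<theta>r i) m M C (\<lambda>s. C w s 0 \<oplus> N s) \<noteq> w} \<le> \<beta>r i m"
    unfolding bchoice_iff by blast
  have "\<exists>\<theta> \<beta>. \<beta> \<longlonglongrightarrow> 0 \<and> (\<forall>m M w. real M \<le> 2 powr (real m * R') + 1 \<longrightarrow> w < M \<longrightarrow>
     measure_pmf.prob (pair_pmf (?Cod m M) (Pi_pmf {..<m} (\<lambda>_. False) (\<lambda>_. bits_pmf (D \<union> F) q)))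
       {(C, N). threshold_decoder (letter_ratio q D F) \<theta> m M C
         (\<lambda>s. letter_output D F (C w s) (N s)) \<noteq> w} \<le> \<beta> m)"
    using fin disj zero _ R'_dest
  proof (rule destination_random_coding)
    show "0 \<le> q i \<and> q i \<le> 1" if "i \<in> D" for i
      using that pd assms(4) by (auto simp: q_def)
  qed
  then obtain \<theta>d \<beta>d where dest: "\<beta>d \<longlonglongrightarrow> 0"
    "\<And>m M w. real M \<le> 2 powr (real m * R') + 1 \<Longrightarrow> w < M \<Longrightarrow>
     measure_pmf.prob (pair_pmf (?Cod m M) (Pi_pmf {..<m} (\<lambda>_. False) (\<lambda>_. bits_pmf {1..K} q)))
       {(C, N). threshold_decoder (letter_ratio q D F) \<theta>d m M C
         (\<lambda>s. letter_output D F (C w s) (N s)) \<noteq> w} \<le> \<beta>d m"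
    unfolding DF by blast

  text \<open>
    With \<open>B\<close> blocks of length \<open>m = n div (B + 1)\<close> the rate drops from \<open>R'\<close> to about
    \<open>R' B / (B + 1)\<close>.
  \<close>
  obtain B :: nat where B: "R < real B * (R' - R)"
    using R'(1) ex_less_of_nat_mult[of "R' - R" R] by auto
  define \<delta> where "\<delta> m = real B * ((\<Sum>i\<in>D. \<beta>r i m) + \<beta>d m)" for m
  have code: "\<exists>c. error_prob K ps pd R n c \<le> \<delta> m"
    if mn: "(B + 1) * m \<le> n" and rate: "real n * R \<le> real m * real B * R'" for m n
  proof -
    \<comment> \<open>Rounding up makes \<open>M ^ B\<close> at least the number of messages, so
      that \<open>B\<close> digits suffice, and stays within the \<open>+ 1\<close> allowed by the
      coding bounds.\<close>
    define M where "M = nat \<lceil>2 powr (real m * R')\<rceil>"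
    have "real M = real_of_int \<lceil>2 powr (real m * R')\<rceil>"
      by (simp add: M_def)
    then have M: "real M \<le> 2 powr (real m * R') + 1" "2 powr (real m * R') \<le> real M"
      by linarith+
    have "2 powr (real n * R) \<le> 2 powr (real m * real B * R')"
      using rate by simp
    also have "\<dots> = (2 powr (real m * R')) ^ B"
      by (simp add: powr_realpow[symmetric] powr_powr mult_ac)
    also have "\<dots> \<le> real M ^ B"
      using M by (intro power_mono) auto
    finally have "num_messages R n \<le> M ^ B"
      unfolding num_messages_def by (simp add: nat_le_iff ceiling_le_iff)
    moreover have "0 < num_messages R n"
      by (simp add: num_messages_def)
    moreover have "measure_pmf.prob (pair_pmf (?Cod m M) (pair_pmf (noise_pmf K n ps) (noise_pmf K n pd)))
      {(C, Z, E). decode (block_code D K m B M (\<lambda>i. threshold_decoder (rr i) (\<theta>r i) m M C)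
          (threshold_decoder (letter_ratio q D F) \<theta>d m M C) C)
        (restrict (dest_received (block_code D K m B M (\<lambda>i. threshold_decoder (rr i) (\<theta>r i) m M C)
          (threshold_decoder (letter_ratio q D F) \<theta>d m M C) C) w Z E) ({1..K} \<times> {1..n})) \<noteq> w}
      \<le> \<delta> m" if "w < M ^ B" for w
      unfolding \<delta>_def
      using ps pd DF that mn
    proof (rule prob_block_code_error_le)
      show "measure_pmf.prob (pair_pmf (?Cod m M) (Pi_pmf {..<m} False (\<lambda>_. bernoulli_pmf (ps i))))
          {(C, N). threshold_decoder (rr i) (\<theta>r i) m M C (\<lambda>s. C v s 0 \<oplus> N s) \<noteq> v} \<le> \<beta>r i m"
        if "i \<in> D" "v < M" for i v
        using relay(2)[OF that(1) M(1) that(2)] .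
      show "measure_pmf.prob (pair_pmf (?Cod m M) (Pi_pmf {..<m} (\<lambda>_. False)
            (\<lambda>_. bits_pmf {1..K} (\<lambda>i. if i \<in> D then pd i else crossover ps pd i))))
          {(C, N). threshold_decoder (letter_ratio q D F) \<theta>d m M C
            (\<lambda>s. letter_output D F (C v s) (N s)) \<noteq> v} \<le> \<beta>d m" if "v < M" for v
        using dest(2)[OF M(1) that] unfolding q_def[abs_def] .
    qed (auto intro: threshold_decoder_cong)
    ultimately show ?thesis
      using ex_code_error_prob_le[of R n "?Cod m M" K ps pd
          "\<lambda>C. block_code D K m B M (\<lambda>i. threshold_decoder (rr i) (\<theta>r i) m M C)
             (threshold_decoder (letter_ratio q D F) \<theta>d m M C) C" "\<delta> m"]
      by (meson less_le_trans)
  qed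
  have "\<delta> \<longlonglongrightarrow> real B * ((\<Sum>i\<in>D. 0) + 0)"
    unfolding \<delta>_def using relay(1) dest(1) by (intro tendsto_intros) auto
  then have \<delta>: "\<delta> \<longlonglongrightarrow> 0" by simp
  show ?thesis
    unfolding achievable_def
  proof (intro conjI allI impI assms(5))
    fix \<epsilon> :: real assume "\<epsilon> > 0"
    have "\<forall>\<^sub>F m in sequentially. \<delta> m < \<epsilon>"
      using \<delta> \<open>\<epsilon> > 0\<close> by (rule order_tendstoD)
    then obtain m0 where m0: "\<And>m. m \<ge> m0 \<Longrightarrow> \<delta> m < \<epsilon>"
      by (auto simp: eventually_sequentially)
    \<comment> \<open>The choice of \<open>B\<close> makes this surplus positive. Per unit of block
      length, \<open>g\<close> is what \<open>B\<close> digits of rate \<open>R'\<close> carry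
      beyond rate \<open>R\<close> over \<open>B + 1\<close> blocks.\<close>
    define g where "g = real B * R' - real (B + 1) * R"
    have "g > 0"
      using B by (simp add: g_def algebra_simps)
    \<comment> \<open>Fewer than \<open>B + 1\<close> time steps are lost when \<open>n\<close> is
      rounded down to a multiple of \<open>B + 1\<close>. From \<open>m1\<close> on the accumulated
      surplus \<open>m * g\<close> covers their cost.\<close>
    obtain m1 :: nat where m1: "real (B + 1) * R < real m1 * g"
      using ex_less_of_nat_mult[OF \<open>g > 0\<close>] by blast
    show "\<forall>\<^sub>F n in sequentially. \<exists>c. error_prob K ps pd R n c < \<epsilon>"
    proof (rule eventually_sequentiallyI)
      fix n assume n: "(B + 1) * max m0 m1 \<le> n"
      define m where "m = n div (B + 1)"
      have "max m0 m1 \<le> m"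
        using n by (simp only: m_def less_eq_div_iff_mult_less_eq mult.commute[of "B + 1"])
      then have m: "m0 \<le> m" "m1 \<le> m"
        by simp_all
      have "n < (B + 1) * (m + 1)"
        unfolding m_def using dividend_less_times_div[of "B + 1" n] by simp
      then have "real n \<le> real ((B + 1) * (m + 1))"
        by linarith
      then have "real n * R \<le> real ((B + 1) * (m + 1)) * R"
        using assms(5) by (rule mult_right_mono)
      also have "\<dots> = real m * (real (B + 1) * R) + real (B + 1) * R"
        by (simp add: algebra_simps)
      also have "\<dots> \<le> real m * (real (B + 1) * R) + real m * g"
        using m1 m(2) \<open>g > 0\<close> mult_right_mono[of "real m1" "real m" g] by linarith
      finally have "real n * R \<le> real m * real B * R'"
        by (simp add: g_def algebra_simps)
      moreover have "(B + 1) * m \<le> n"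
        unfolding m_def by (rule times_div_less_eq_dividend)
      ultimately show "\<exists>c. error_prob K ps pd R n c < \<epsilon>"
        using code m0[OF m(1)] by (meson le_less_trans)
    qed
  qed
qed

end
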